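(* Let $\mathcal C\subset\mathbb{RP}^2$ be a non-degenerate cubic that is the isogonal cubic of some quadrilateral with vertices in $\mathbb R^2$. Then for any point $X\in\mathcal C$ there is only one possible point $X'\in\mathcal C$ which can be the isogonal conjugate of $X$: if $\mathcal C$ is the isogonal cubic of $ABCD$ and also of $A_1B_1C_1D_1$ (all vertices in $\mathbb R^2$), then the isogonal conjugate of $X$ in $ABCD$ equals the isogonal conjugate of $X$ in $A_1B_1C_1D_1$.
   Context: A cubic is non-degenerate if it is irreducible. Quadrilaterals have distinct vertices but may be self-intersecting, and some vertices may be collinear. Isogonality: pairs of lines $(XA,XC)$, $(XB,XD)$ through a point $X\in\mathbb R^2$ are isogonal if they have the same pair of angle bisectors. If $X$ is a real point at infinity, they are isogonal if for every line meeting $XA,XB,XC,XD$ at finite points $E,F,G,H$ the directed lengths $EF$ and $HG$ are equal (i.e. the parallel lines $XA,XC$ have the same midline as $XB,XD$). The isogonal cubic of $ABCD$ is the locus of points $X\in\mathbb{RP}^2$ for which $(XA,XC)$ and $(XB,XD)$ are isogonal; identifying $\mathbb R^2$ with the complex plane, with lower-case letters for complex coordinates, its equation is $(x-b)(x-d)\,\overline{(x-a)(x-c)}=\overline{(x-b)(x-d)}\,(x-a)(x-c)$, completed projectively. Points $X,X'$ are isogonal conjugates in $ABCD$ if $(AX,AX')$ and $(AB,AD)$ are isogonal and the analogous condition holds at the other vertices $B,C,D$ (each with its two neighbouring vertices). Here, for a point $U\in\mathcal C$, $UU$ denotes the tangent to $\mathcal C$ at $U$; with this convention $A,C$ are isogonal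 conjugates, and so are $B,D$. Every point of the isogonal cubic has a unique isogonal conjugate in $ABCD$, which lies on the cubic. *)

theory Defs
  imports "HOL-Analysis.Analysis" "HOL-Computational_Algebra.Polynomial"
begin

section \<open>The real projective plane\<close>

text \<open>
  \<open>\<real>\<^sup>2\<close> is identified with \<open>complex\<close>, and the real projective plane is the set of
  one-dimensional subspaces of \<open>complex \<times> real\<close>, i.e. \<open>(w, t)\<close> are the homogeneous coordinates
  \<open>[Re w : Im w : t]\<close>. The points at infinity are those with \<open>t = 0\<close>, and projective lines are
  the two-dimensional subspaces.
\<close>

definition RP2 :: "(complex \<times> real) set set" where
  "RP2 = {P. subspace P \<and> dim P = 1}"

definition fin_pt :: "complex \<Rightarrow> (complex \<times> real) set" where
  "fin_pt z = span {(z, 1)}"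

definition line_through :: "(complex \<times> real) set \<Rightarrow> (complex \<times> real) set \<Rightarrow> (complex \<times> real) set" where
  "line_through P Q = span (P \<union> Q)"

definition affine_part :: "(complex \<times> real) set \<Rightarrow> complex set" where
  "affine_part L = {z. (z, 1) \<in> L}"

definition zero_locus :: "(complex \<times> real \<Rightarrow> real) \<Rightarrow> (complex \<times> real) set set" where
  "zero_locus F = {P \<in> RP2. \<forall>v\<in>P. F v = 0}"


section \<open>Non-degenerate cubics\<close>

text \<open>
  Elements of \<open>\<real>[X, Y, Z]\<close> are nested univariate polynomials: the coefficient of
  \<open>X\<^sup>i Y\<^sup>j Z\<^sup>k\<close> in \<open>F\<close> is \<open>coeff (coeff (coeff F i) j) k\<close>.
  For a real cubic form, irreducibility over the reals and over the complex numbers agree: a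
  non-real linear factor comes with its conjugate, and the cofactor is a real linear form.
\<close>

definition homogeneous :: "nat \<Rightarrow> real poly poly poly \<Rightarrow> bool" where
  "homogeneous m F \<longleftrightarrow> (\<forall>i j k. coeff (coeff (coeff F i) j) k \<noteq> 0 \<longrightarrow> i + j + k = m)"

definition eval3 :: "real poly poly poly \<Rightarrow> complex \<times> real \<Rightarrow> real" where
  "eval3 F = (\<lambda>(w, t). poly (poly (poly F [:[:Re w:]:]) [:Im w:]) t)"

definition nondegenerate_cubic :: "(complex \<times> real) set set \<Rightarrow> bool" where
  "nondegenerate_cubic K \<longleftrightarrow> (\<exists>F. homogeneous 3 F \<and> irreducible F \<and> K = zero_locus (eval3 F))"


section \<open>Isogonal pairs of lines\<close>

definition line_reflection :: "complex set \<Rightarrow> complex \<Rightarrow> complex" where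
  "line_reflection n z = 2 * closest_point n z - z"

text \<open>
  The reflection condition also covers coincident lines, whose angle bisectors are the line
  itself and its perpendicular.
\<close>

definition angle_bisectors :: "complex \<Rightarrow> complex set \<Rightarrow> complex set \<Rightarrow> complex set set" where
  "angle_bisectors x l l' =
     {n. affine n \<and> aff_dim n = 1 \<and> x \<in> n \<and> line_reflection n ` l = l'}"

definition isogonal :: "complex \<Rightarrow> complex set \<Rightarrow> complex set \<Rightarrow> complex set \<Rightarrow> complex set \<Rightarrow> bool" where
  "isogonal x l l' m m' \<longleftrightarrow> angle_bisectors x l l' = angle_bisectors x m m'"

definition isogonal_at_infinity ::
    "complex set \<Rightarrow> complex set \<Rightarrow> complex set \<Rightarrow> complex set \<Rightarrow> bool" where
  "isogonal_at_infinity l l' m m' \<longleftrightarrow>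
     (\<forall>n e f g h. affine n \<and> aff_dim n = 1 \<and>
        n \<inter> l = {e} \<and> n \<inter> m = {f} \<and> n \<inter> l' = {g} \<and> n \<inter> m' = {h} \<longrightarrow> f - e = g - h)"


section \<open>The isogonal cubic\<close>

definition quadrilateral :: "complex \<Rightarrow> complex \<Rightarrow> complex \<Rightarrow> complex \<Rightarrow> bool" where
  "quadrilateral a b c d \<longleftrightarrow> distinct [a, b, c, d]"

text \<open>
  Homogenising \<open>(x - b)(x - d) cnj ((x - a)(x - c)) = cnj ((x - b)(x - d)) (x - a)(x - c)\<close> in
  degree 4 with \<open>x = w / t\<close>, both sides have the term \<open>\<bar>w\<bar>\<^sup>4\<close>, so the difference is divisible
  by \<open>t\<close>. The form below is the quotient, up to the factor \<open>2 \<i>\<close>; see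
  \<open>isogonal_form_completion\<close>.
\<close>

definition isogonal_form ::
    "complex \<Rightarrow> complex \<Rightarrow> complex \<Rightarrow> complex \<Rightarrow> complex \<times> real \<Rightarrow> real" where
  "isogonal_form a b c d = (\<lambda>(w, t).
     let r = (b + d) * w - b * d * of_real t;
         s = (a + c) * w - a * c * of_real t
     in Im (of_real t * r * cnj s - r * cnj (w\<^sup>2) - w\<^sup>2 * cnj s))"

definition isogonal_cubic ::
    "complex \<Rightarrow> complex \<Rightarrow> complex \<Rightarrow> complex \<Rightarrow> (complex \<times> real) set set" where
  "isogonal_cubic a b c d = zero_locus (isogonal_form a b c d)"


section \<open>Isogonal conjugates\<close>

definition tangent_line ::
    "(complex \<times> real \<Rightarrow> real) \<Rightarrow> complex \<times> real \<Rightarrow> (complex \<times> real) set" where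
  "tangent_line F u = {v. frechet_derivative F (at u) v = 0}"

text \<open>
  The line joining the vertex \<open>u\<close> to the point \<open>X\<close>, read as the tangent to the isogonal cubic
  if \<open>X\<close> is \<open>u\<close> itself. The vertices are always smooth points of the cubic.
\<close>

definition vertex_line ::
    "complex \<Rightarrow> complex \<Rightarrow> complex \<Rightarrow> complex \<Rightarrow> complex \<Rightarrow> (complex \<times> real) set \<Rightarrow> complex set" where
  "vertex_line a b c d u X = affine_part
     (if X = fin_pt u then tangent_line (isogonal_form a b c d) (u, 1)
      else line_through (fin_pt u) X)"

definition isogonal_conjugates ::
    "complex \<Rightarrow> complex \<Rightarrow> complex \<Rightarrow> complex \<Rightarrow>
     (complex \<times> real) set \<Rightarrow> (complex \<times> real) set \<Rightarrow> bool" where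
  "isogonal_conjugates a b c d X X' \<longleftrightarrow> X \<in> RP2 \<and> X' \<in> RP2 \<and>
     (let L = vertex_line a b c d in
        isogonal a (L a X) (L a X') (L a (fin_pt b)) (L a (fin_pt d)) \<and>
        isogonal b (L b X) (L b X') (L b (fin_pt a)) (L b (fin_pt c)) \<and>
        isogonal c (L c X) (L c X') (L c (fin_pt b)) (L c (fin_pt d)) \<and>
        isogonal d (L d X) (L d X') (L d (fin_pt c)) (L d (fin_pt a)))"


section \<open>The isogonal cubic as a locus\<close>

lemma isogonal_form_completion:
  "2 * \<i> * of_real (t * isogonal_form a b c d (w, t)) =
     (w - b * of_real t) * (w - d * of_real t) * cnj ((w - a * of_real t) * (w - c * of_real t)) -
     cnj ((w - b * of_real t) * (w - d * of_real t)) * ((w - a * of_real t) * (w - c * of_real t))"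
  by (simp add: complex_eq_iff isogonal_form_def Let_def power2_eq_square algebra_simps)

lemma isogonal_form_scale: "isogonal_form a b c d (k *\<^sub>R v) = k ^ 3 * isogonal_form a b c d v"
  by (cases v) (simp add: isogonal_form_def Let_def power2_eq_square power3_eq_cube
      scaleR_conv_of_real algebra_simps)

lemma dim_span_singleton: "v \<noteq> 0 \<Longrightarrow> dim (span {v}) = 1"
  for v :: "'a::euclidean_space"
  by (simp add: dim_span)

lemma span_in_isogonal_cubic:
  assumes "v \<noteq> 0"
  shows "span {v} \<in> isogonal_cubic a b c d \<longleftrightarrow> isogonal_form a b c d v = 0"
proof -
  have "(\<forall>u\<in>span {v}. isogonal_form a b c d u = 0) \<longleftrightarrow> isogonal_form a b c d v = 0"
    by (auto simp: span_singleton isogonal_form_scale simp del: scaleR_Pair)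
  then show ?thesis
    by (simp add: isogonal_cubic_def zero_locus_def RP2_def dim_span_singleton assms del: dim_span)
qed

lemma isogonal_cubic_finite:
  "fin_pt x \<in> isogonal_cubic a b c d \<longleftrightarrow>
     (x - b) * (x - d) * cnj ((x - a) * (x - c)) = cnj ((x - b) * (x - d)) * ((x - a) * (x - c))"
  using isogonal_form_completion[of 1 a b c d x]
  by (auto simp: fin_pt_def span_in_isogonal_cubic zero_prod_def)

definition line_dir :: "complex \<Rightarrow> complex \<Rightarrow> complex set" where
  "line_dir x u = range (\<lambda>k::real. x + of_real k * u)"

lemma line_dir_eq: "u \<noteq> 0 \<Longrightarrow> z \<in> line_dir x u \<longleftrightarrow> Im ((z - x) * cnj u) = 0"
proof
  assume u: "u \<noteq> 0" and im: "Im ((z - x) * cnj u) = 0"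
  have "(z - x) * cnj u = of_real (Re ((z - x) * cnj u))"
    using im by (simp add: complex_eq_iff)
  then have "(z - x) * cnj u * u = of_real (Re ((z - x) * cnj u)) * u"
    by (rule arg_cong)
  moreover have "u * cnj u \<noteq> 0" using u by simp
  ultimately have "z - x = of_real (Re ((z - x) * cnj u)) * u / (u * cnj u)"
    by (metis (no_types, lifting) mult.assoc mult.commute nonzero_eq_divide_eq)
  then have "z = x + of_real (Re ((z - x) * cnj u) / (cmod u)\<^sup>2) * u"
    unfolding of_real_divide complex_norm_square
    by (simp only: times_divide_eq_left diff_eq_eq add.commute)
  then show "z \<in> line_dir x u" unfolding line_dir_def by blast
qed (auto simp: line_dir_def)

lemma line_dir_dir:
  assumes "u \<noteq> 0" "v \<noteq> 0"
  shows "line_dir x u = line_dir x v \<longleftrightarrow> Im (u * cnj v) = 0"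
proof
  assume "line_dir x u = line_dir x v"
  moreover have "x + u \<in> line_dir x u" using assms by (simp add: line_dir_eq)
  ultimately show "Im (u * cnj v) = 0" using assms by (simp add: line_dir_eq)
next
  assume "Im (u * cnj v) = 0"
  then have "u \<in> line_dir 0 v" using assms by (simp add: line_dir_eq)
  then obtain k :: real where k: "u = of_real k * v" by (auto simp: line_dir_def)
  then have "k \<noteq> 0" using assms by auto
  show "line_dir x u = line_dir x v"
  proof -
    have "x + of_real l * u = x + of_real (l * k) * v" for l :: real by (simp add: k)
    moreover have "x + of_real l * v = x + of_real (l / k) * u" for l :: real
      using \<open>k \<noteq> 0\<close> by (simp add: k)
    ultimately show ?thesis unfolding line_dir_def by blast
  qed
qed

lemma affine_line_dir: "affine (line_dir x u)"
  unfolding affine_def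
proof (intro ballI allI impI)
  fix y z and p q :: real assume "y \<in> line_dir x u" "z \<in> line_dir x u" and pq: "p + q = 1"
  then obtain k l :: real where "y = x + of_real k * u" "z = x + of_real l * u"
    by (auto simp: line_dir_def)
  moreover from pq have "q = 1 - p" by simp
  ultimately have "p *\<^sub>R y + q *\<^sub>R z = x + of_real (p * k + q * l) * u"
    by (simp add: scaleR_conv_of_real ring_distribs)
  then show "p *\<^sub>R y + q *\<^sub>R z \<in> line_dir x u" unfolding line_dir_def by blast
qed

lemma line_dir_affine_hull: "line_dir x u = affine hull {x, x + u}"
proof -
  have "(\<exists>p q. z = p *\<^sub>R x + q *\<^sub>R (x + u) \<and> p + q = 1) \<longleftrightarrow> z \<in> line_dir x u" for z
  proof
    assume "\<exists>p q. z = p *\<^sub>R x + q *\<^sub>R (x + u) \<and> p + q = 1"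
    then obtain p q where z: "z = p *\<^sub>R x + q *\<^sub>R (x + u)" and "p + q = 1" by blast
    then have "p = 1 - q" by simp
    then have "z = x + of_real q * u" using z by (simp add: scaleR_conv_of_real ring_distribs)
    then show "z \<in> line_dir x u" unfolding line_dir_def by blast
  next
    assume "z \<in> line_dir x u"
    then obtain q :: real where "z = x + of_real q * u" by (auto simp: line_dir_def)
    then have "z = (1 - q) *\<^sub>R x + q *\<^sub>R (x + u)" by (simp add: scaleR_conv_of_real algebra_simps)
    then show "\<exists>p q. z = p *\<^sub>R x + q *\<^sub>R (x + u) \<and> p + q = 1" by (metis diff_add_cancel)
  qed
  then show ?thesis by (auto simp: affine_hull_2)
qed

lemma affine_line_iff:
  "affine n \<and> aff_dim n = 1 \<and> x \<in> n \<longleftrightarrow> (\<exists>u. u \<noteq> 0 \<and> n = line_dir x u)"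
proof
  assume n: "affine n \<and> aff_dim n = 1 \<and> x \<in> n"
  then have "n \<noteq> {x}" by auto
  then obtain y where y: "y \<in> n" "y \<noteq> x" using n by blast
  have "affine hull {x, y} = n"
    using n y by (intro affine_dim_equal) (auto simp: hull_minimal subset_hull)
  then have "n = line_dir x (y - x)" by (simp add: line_dir_affine_hull)
  then show "\<exists>u. u \<noteq> 0 \<and> n = line_dir x u" using y by (intro exI[of _ "y - x"]) auto
next
  assume "\<exists>u. u \<noteq> 0 \<and> n = line_dir x u"
  then show "affine n \<and> aff_dim n = 1 \<and> x \<in> n"
    by (auto simp: line_dir_affine_hull aff_dim_2 hull_inc)
qed

lemma line_reflection_line_dir:
  assumes "u \<noteq> 0"
  shows "line_reflection (line_dir x u) (x + w) = x + u * cnj w / cnj u"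
proof -
  let ?p = "x + of_real (Re (w * cnj u) / (cmod u)\<^sup>2) * u"
  have "?p = closest_point (line_dir x u) (x + w)"
  proof (rule closest_point_unique)
    show "convex (line_dir x u)" by (simp add: affine_imp_convex affine_line_dir)
    show "closed (line_dir x u)" unfolding line_dir_affine_hull by simp
    show "?p \<in> line_dir x u" unfolding line_dir_def by blast
    show "\<forall>z\<in>line_dir x u. dist (x + w) ?p \<le> dist (x + w) z"
    proof
      fix z assume "z \<in> line_dir x u"
      then obtain k :: real where z: "z = x + of_real k * u" by (auto simp: line_dir_def)
      define l where "l = Re (w * cnj u) / (cmod u)\<^sup>2"
      have l: "l * (u \<bullet> u) = w \<bullet> u"
        using assms by (simp add: l_def dot_square_norm) (simp add: inner_complex_def)
      have "orthogonal (w - l *\<^sub>R u) ((l - k) *\<^sub>R u)"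
        using l by (simp add: orthogonal_def inner_diff_left)
      then have "(norm (w - l *\<^sub>R u + (l - k) *\<^sub>R u))\<^sup>2
          = (norm (w - l *\<^sub>R u))\<^sup>2 + (norm ((l - k) *\<^sub>R u))\<^sup>2"
        by (rule norm_add_Pythagorean)
      then have "(norm (w - l *\<^sub>R u))\<^sup>2 \<le> (norm (w - k *\<^sub>R u))\<^sup>2"
        by (simp add: scaleR_left_diff_distrib)
      then have "norm (w - l *\<^sub>R u) \<le> norm (w - k *\<^sub>R u)" by simp
      then show "dist (x + w) ?p \<le> dist (x + w) z"
        unfolding z l_def dist_norm by (simp add: scaleR_conv_of_real)
    qed
  qed
  then have "line_reflection (line_dir x u) (x + w) = 2 * ?p - (x + w)"
    by (simp add: line_reflection_def)
  also have "2 * of_real (Re (w * cnj u) / (cmod u)\<^sup>2) * u - w = u * cnj w / cnj u"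
  proof -
    have "2 * complex_of_real (Re (w * cnj u)) = w * cnj u + cnj w * u"
      by (simp add: complex_eq_iff)
    moreover have "complex_of_real ((cmod u)\<^sup>2) = u * cnj u"
      by (metis complex_norm_square)
    ultimately show ?thesis using assms
      by (simp add: field_simps del: of_real_power)
  qed
  then have "2 * ?p - (x + w) = x + u * cnj w / cnj u" by (simp add: algebra_simps)
  finally show ?thesis .
qed

lemma angle_bisectors_line_dir:
  assumes "u \<noteq> 0" "v \<noteq> 0"
  shows "angle_bisectors x (line_dir x u) (line_dir x v) =
           {line_dir x n | n. n \<noteq> 0 \<and> Im (u * v * cnj (n\<^sup>2)) = 0}"
proof -
  have img: "line_reflection (line_dir x n) ` line_dir x u = line_dir x (n * cnj u / cnj n)"
    if "n \<noteq> 0" for n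
  proof -
    have "line_reflection (line_dir x n) (x + of_real k * u) = x + of_real k * (n * cnj u / cnj n)"
      for k :: real
      using line_reflection_line_dir[OF that, of x "of_real k * u"] by simp
    then show ?thesis unfolding line_dir_def[of x u] line_dir_def[of x "n * cnj u / cnj n"]
      by (simp add: image_image)
  qed
  have bis: "line_reflection (line_dir x n) ` line_dir x u = line_dir x v \<longleftrightarrow> Im (u * v * cnj (n\<^sup>2)) = 0"
    if n: "n \<noteq> 0" for n
  proof -
    have "n * cnj u / cnj n * cnj v = cnj (u * v * cnj (n\<^sup>2)) / of_real ((cmod n)\<^sup>2)"
      using n unfolding complex_norm_square by (simp add: power2_eq_square field_simps)
    then have "Im (n * cnj u / cnj n * cnj v) = - Im (u * v * cnj (n\<^sup>2)) / (cmod n)\<^sup>2"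
      by (simp only: Im_divide_of_real cnj.sel)
    then have "Im (n * cnj u / cnj n * cnj v) = 0 \<longleftrightarrow> Im (u * v * cnj (n\<^sup>2)) = 0"
      using n by (simp only: divide_eq_0_iff neg_equal_0_iff_equal power_eq_0_iff norm_eq_zero) simp
    moreover have "n * cnj u / cnj n \<noteq> 0" using n assms by simp
    ultimately show ?thesis
      using line_dir_dir[of "n * cnj u / cnj n" v x] assms(2) unfolding img[OF n] by blast
  qed
  have "angle_bisectors x (line_dir x u) (line_dir x v) =
      {m. (\<exists>n. n \<noteq> 0 \<and> m = line_dir x n) \<and> line_reflection m ` line_dir x u = line_dir x v}"
    unfolding angle_bisectors_def affine_line_iff[symmetric] by simp
  also have "\<dots> = {line_dir x n | n. n \<noteq> 0 \<and> Im (u * v * cnj (n\<^sup>2)) = 0}"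
    using bis by (intro Collect_cong iffI; elim conjE exE) (metis+)
  finally show ?thesis .
qed

lemma isogonal_line_dir:
  assumes "u \<noteq> 0" "u' \<noteq> 0" "v \<noteq> 0" "v' \<noteq> 0"
  shows "isogonal x (line_dir x u) (line_dir x u') (line_dir x v) (line_dir x v') \<longleftrightarrow>
           Im (u * u' * cnj (v * v')) = 0"
proof
  assume iso: "isogonal x (line_dir x u) (line_dir x u') (line_dir x v) (line_dir x v')"
  define n where "n = csqrt (u * u')"
  have n: "n\<^sup>2 = u * u'" "n \<noteq> 0" using assms by (auto simp: n_def)
  have "Im (u * u' * cnj (n\<^sup>2)) = 0" unfolding n by (simp add: algebra_simps)
  then have "line_dir x n \<in> angle_bisectors x (line_dir x v) (line_dir x v')"
    using iso n(2) unfolding isogonal_def angle_bisectors_line_dir[OF assms(1,2)] by blast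
  then obtain n' where n': "line_dir x n = line_dir x n'" "n' \<noteq> 0" "Im (v * v' * cnj (n'\<^sup>2)) = 0"
    unfolding angle_bisectors_line_dir[OF assms(3,4)] by blast
  then have "n \<in> line_dir 0 n'" using n line_dir_dir[of n n' x] by (simp add: line_dir_eq)
  then obtain k :: real where k: "n = of_real k * n'" by (auto simp: line_dir_def)
  have "u * u' * cnj (v * v') = of_real (k\<^sup>2) * cnj (v * v' * cnj (n'\<^sup>2))"
    unfolding n(1)[symmetric] k by (simp add: power_mult_distrib algebra_simps)
  then show "Im (u * u' * cnj (v * v')) = 0"
    using n'(3) by (simp only: Im_complex_of_real times_complex.sel(2) cnj.sel)
next
  assume "Im (u * u' * cnj (v * v')) = 0"
  then have "u * u' \<in> line_dir 0 (v * v')" using assms by (simp add: line_dir_eq)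
  then obtain k :: real where k: "u * u' = of_real k * (v * v')" by (auto simp: line_dir_def)
  then have "k \<noteq> 0" using assms by auto
  then have "Im (u * u' * cnj (n\<^sup>2)) = 0 \<longleftrightarrow> Im (v * v' * cnj (n\<^sup>2)) = 0" for n
    unfolding k mult.assoc by (simp only: times_complex.sel Re_complex_of_real Im_complex_of_real) simp
  then show "isogonal x (line_dir x u) (line_dir x u') (line_dir x v) (line_dir x v')"
    using assms by (simp add: isogonal_def angle_bisectors_line_dir)
qed

lemma affine_part_line_through:
  "affine_part (line_through (fin_pt x) (span {v})) = line_dir x (fst v - of_real (snd v) * x)"
proof -
  have "z \<in> affine_part (line_through (fin_pt x) (span {v})) \<longleftrightarrow>
          (\<exists>k l. z = of_real k * x + of_real l * fst v \<and> 1 = k + l * snd v)" for z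
  proof -
    have "z \<in> affine_part (line_through (fin_pt x) (span {v})) \<longleftrightarrow>
            (\<exists>k l. (z, 1) = k *\<^sub>R (x, 1) + l *\<^sub>R v)"
      unfolding affine_part_def line_through_def fin_pt_def span_Un span_span
      by (fastforce simp: span_singleton simp del: scaleR_Pair add_Pair)
    then show ?thesis by (cases v) (simp add: scaleR_conv_of_real)
  qed
  moreover have "(\<exists>k l. z = of_real k * x + of_real l * fst v \<and> 1 = k + l * snd v) \<longleftrightarrow>
      z \<in> line_dir x (fst v - of_real (snd v) * x)" for z
  proof
    assume "\<exists>k l. z = of_real k * x + of_real l * fst v \<and> 1 = k + l * snd v"
    then obtain k l where z: "z = of_real k * x + of_real l * fst v" "1 = k + l * snd v" by blast
    then have "k = 1 - l * snd v" by simp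
    then have "z = x + of_real l * (fst v - of_real (snd v) * x)" using z(1) by (simp add: ring_distribs)
    then show "z \<in> line_dir x (fst v - of_real (snd v) * x)" unfolding line_dir_def by blast
  next
    assume "z \<in> line_dir x (fst v - of_real (snd v) * x)"
    then obtain l :: real where "z = x + of_real l * (fst v - of_real (snd v) * x)"
      by (auto simp: line_dir_def)
    then have "z = of_real (1 - l * snd v) * x + of_real l * fst v" by (simp add: algebra_simps)
    then show "\<exists>k l. z = of_real k * x + of_real l * fst v \<and> 1 = k + l * snd v"
      by (intro exI[of _ "1 - l * snd v"] exI[of _ l]) simp
  qed
  ultimately show ?thesis by blast
qed

theorem isogonal_cubic_locus_finite:
  assumes "x \<notin> {a, b, c, d}"
  defines "L \<equiv> \<lambda>y. affine_part (line_through (fin_pt x) (fin_pt y))"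
  shows "fin_pt x \<in> isogonal_cubic a b c d \<longleftrightarrow> isogonal x (L a) (L c) (L b) (L d)"
proof -
  have L: "L y = line_dir x (y - x)" for y
    using affine_part_line_through[of x "(y, 1)"] by (simp add: L_def fin_pt_def)
  have "isogonal x (L a) (L c) (L b) (L d) \<longleftrightarrow>
          Im ((a - x) * (c - x) * cnj ((b - x) * (d - x))) = 0"
    unfolding L using assms(1) by (intro isogonal_line_dir) auto
  moreover have "fin_pt x \<in> isogonal_cubic a b c d \<longleftrightarrow>
      (let q = (x - a) * (x - c) * cnj ((x - b) * (x - d)) in cnj q = q)"
    unfolding isogonal_cubic_finite Let_def by (simp add: mult_ac)
  moreover have "(x - a) * (x - c) * cnj ((x - b) * (x - d)) =
      (a - x) * (c - x) * cnj ((b - x) * (d - x))"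
    by (simp add: algebra_simps)
  moreover have "cnj q = q \<longleftrightarrow> Im q = 0" for q by (auto simp: complex_eq_iff)
  ultimately show ?thesis by (simp only: Let_def)
qed

theorem isogonal_cubic_locus_infinite:
  assumes "v \<noteq> 0"
  defines "P \<equiv> span {(v, 0)}"
  defines "L \<equiv> \<lambda>y. affine_part (line_through (fin_pt y) P)"
  shows "P \<in> isogonal_cubic a b c d \<longleftrightarrow> isogonal_at_infinity (L a) (L c) (L b) (L d)"
proof -
  have L: "L y = line_dir y v" for y
    using affine_part_line_through[of y "(v, 0)"] by (simp add: L_def P_def)
  define s where "s = b + d - a - c"
  have "isogonal_form a b c d (v, 0) = Im ((b + d) * v * - cnj (v\<^sup>2) - v\<^sup>2 * cnj ((a + c) * v))"
    by (simp add: isogonal_form_def Let_def power2_eq_square algebra_simps)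
  also have "\<dots> = - (cmod v)\<^sup>2 * Im (s * cnj v)"
    unfolding cmod_power2 s_def by (simp add: power2_eq_square algebra_simps)
  finally have P: "P \<in> isogonal_cubic a b c d \<longleftrightarrow> Im (s * cnj v) = 0"
    unfolding P_def using assms(1) by (simp add: span_in_isogonal_cubic zero_prod_def)
  have "isogonal_at_infinity (L a) (L c) (L b) (L d) \<longleftrightarrow> Im (s * cnj v) = 0"
  proof
    assume iso: "isogonal_at_infinity (L a) (L c) (L b) (L d)"
    define n where "n = line_dir 0 (\<i> * v)"
    define p where "p y = \<i> * v * of_real (Im (y * cnj v) / (cmod v)\<^sup>2)" for y
    have n: "affine n \<and> aff_dim n = 1 \<and> 0 \<in> n"
      using affine_line_iff[of n 0] assms(1) by (auto simp: n_def intro!: exI[of _ "\<i> * v"])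
    have vv: "(cmod v)\<^sup>2 = Re v * Re v + Im v * Im v" "(cmod v)\<^sup>2 \<noteq> 0"
      using assms(1) unfolding cmod_power2 by (simp_all add: power2_eq_square complex_eq_iff)
    have int: "n \<inter> L y = {p y}" for y
    proof -
      have "z \<in> n \<inter> L y \<longleftrightarrow> z = p y" for z
      proof
        assume "z \<in> n \<inter> L y"
        then have "z \<in> n" and im: "Im ((z - y) * cnj v) = 0"
          using assms(1) by (simp_all add: L line_dir_eq)
        then obtain k :: real where z: "z = of_real k * (\<i> * v)"
          by (auto simp: n_def line_dir_def)
        from im have "k * (cmod v)\<^sup>2 = Im (y * cnj v)"
          unfolding vv(1) z by (simp add: algebra_simps)
        then have "k = Im (y * cnj v) / (cmod v)\<^sup>2" using vv(2) by (simp add: field_simps)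
        then show "z = p y" by (simp add: z p_def)
      next
        assume z: "z = p y"
        define k where "k = Im (y * cnj v) / (cmod v)\<^sup>2"
        have k: "k * (cmod v)\<^sup>2 = Im (y * cnj v)" using vv(2) by (simp add: k_def)
        have z: "z = 0 + of_real k * (\<i> * v)" by (simp add: z p_def k_def)
        have "z \<in> n" unfolding n_def line_dir_def using z by blast
        moreover have "Im ((z - y) * cnj v) = 0"
          using k unfolding vv(1) z by (simp add: algebra_simps)
        ultimately show "z \<in> n \<inter> L y" using assms(1) by (simp add: L line_dir_eq)
      qed
      then show ?thesis by blast
    qed
    have "p b - p a = p c - p d"
      using iso n int unfolding isogonal_at_infinity_def by blast
    then have "of_real (Im (b * cnj v) / (cmod v)\<^sup>2) - of_real (Im (a * cnj v) / (cmod v)\<^sup>2) =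
        (of_real (Im (c * cnj v) / (cmod v)\<^sup>2) - of_real (Im (d * cnj v) / (cmod v)\<^sup>2) :: complex)"
      using assms(1) unfolding p_def right_diff_distrib[symmetric] by simp
    then have "Im (b * cnj v) / (cmod v)\<^sup>2 - Im (a * cnj v) / (cmod v)\<^sup>2 =
        Im (c * cnj v) / (cmod v)\<^sup>2 - Im (d * cnj v) / (cmod v)\<^sup>2"
      by (metis of_real_diff of_real_eq_iff)
    then have "Im (b * cnj v) - Im (a * cnj v) = Im (c * cnj v) - Im (d * cnj v)"
      using vv(2) by (simp add: diff_divide_distrib[symmetric])
    then show "Im (s * cnj v) = 0" by (simp add: s_def algebra_simps)
  next
    assume s: "Im (s * cnj v) = 0"
    show "isogonal_at_infinity (L a) (L c) (L b) (L d)"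
      unfolding isogonal_at_infinity_def
    proof (intro allI impI, elim conjE)
      fix n e f g h
      assume n: "affine n" "aff_dim n = 1" and
        int: "n \<inter> L a = {e}" "n \<inter> L b = {f}" "n \<inter> L c = {g}" "n \<inter> L d = {h}"
      obtain u where u: "u \<noteq> 0" "n = line_dir e u" using affine_line_iff[of n e] n int(1) by blast
      have ea: "Im ((e - a) * cnj v) = 0" "Im ((f - b) * cnj v) = 0"
               "Im ((g - c) * cnj v) = 0" "Im ((h - d) * cnj v) = 0"
        using int assms(1) line_dir_eq[of v] unfolding L by blast+
      have uv: "Im (u * cnj v) \<noteq> 0"
      proof
        assume "Im (u * cnj v) = 0"
        then have "Im ((e + u - a) * cnj v) = 0" using ea(1) by (simp add: algebra_simps)
        then have "e + u \<in> n \<inter> L a" using u assms(1) by (simp add: L line_dir_eq)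
        then have "e + u = e" using int(1) by blast
        then show False using u(1) by simp
      qed
      have "f \<in> n" "g \<in> n" "h \<in> n" using int by blast+
      then obtain k l m :: real where
        klm: "f = e + of_real k * u" "g = e + of_real l * u" "h = e + of_real m * u"
        unfolding u line_dir_def by blast
      have "Im ((f - e - (g - h)) * cnj v) = 0"
        using ea s by (simp add: s_def algebra_simps)
      moreover have "(f - e - (g - h)) * cnj v = of_real (k - l + m) * (u * cnj v)"
        by (simp add: klm algebra_simps)
      ultimately have "(k - l + m) * Im (u * cnj v) = 0"
        by (simp only: times_complex.sel Re_complex_of_real Im_complex_of_real)
      then have "k = l - m" using uv by simp
      then show "f - e = g - h" by (simp add: klm ring_distribs)
    qed
  qed
  then show ?thesis using P by simp
qed


section \<open>The tangents at the vertices\<close>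

lemma frechet_derivative_isogonal_form:
  "frechet_derivative (isogonal_form a b c d) (at (a, 1)) =
     (\<lambda>(w, t). Im ((a - b) * (a - d) * cnj ((w - of_real t * a) * (a - c))))"
proof (rule frechet_derivative_at[symmetric])
  have "isogonal_form a b c d = (\<lambda>p.
     let r = (b + d) * fst p - b * d * of_real (snd p);
         s = (a + c) * fst p - a * c * of_real (snd p)
     in Im (of_real (snd p) * r * cnj s - r * cnj (fst p ^ 2) - fst p ^ 2 * cnj s))"
    by (simp add: isogonal_form_def case_prod_unfold)
  then show "(isogonal_form a b c d has_derivative
     (\<lambda>(w, t). Im ((a - b) * (a - d) * cnj ((w - of_real t * a) * (a - c))))) (at (a, 1))"
    unfolding Let_def
    apply (simp only:)
    apply (rule derivative_eq_intros bounded_linear.has_derivative[OF bounded_linear_Im]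
      bounded_linear.has_derivative[OF bounded_linear_cnj]
      bounded_linear.has_derivative[OF bounded_linear_of_real] refl)+
    apply (rule ext)
    apply (simp add: case_prod_unfold power2_eq_square algebra_simps)
    done
qed

lemma isogonal_form_swap: "isogonal_form c b a d = isogonal_form a b c d"
  by (simp add: isogonal_form_def add.commute mult.commute)

lemma fin_pt_inj: "fin_pt x = fin_pt y \<longleftrightarrow> x = y"
proof
  assume "fin_pt x = fin_pt y"
  moreover have "(x, 1) \<in> fin_pt x" unfolding fin_pt_def by (intro span_base) simp
  ultimately have "(x, 1) \<in> span {(y, 1::real)}" by (simp add: fin_pt_def)
  then show "x = y" by (auto simp: span_singleton)
qed simp

lemma vertex_line_other: "u \<noteq> y \<Longrightarrow> vertex_line a b c d u (fin_pt y) = line_dir u (y - u)"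
  using affine_part_line_through[of u "(y, 1)"]
  by (simp add: vertex_line_def fin_pt_inj fin_pt_def[symmetric])

lemma vertex_line_tangent:
  assumes "quadrilateral a b c d"
  shows "vertex_line a b c d a (fin_pt a) = line_dir a ((a - b) * (a - d) * cnj (a - c))"
proof -
  define k where "k = (a - b) * (a - d) * cnj (a - c)"
  have "k \<noteq> 0" using assms by (simp add: k_def quadrilateral_def)
  moreover have "(a - b) * (a - d) * cnj ((z - a) * (a - c)) = cnj ((z - a) * cnj k)" for z
    by (simp add: k_def mult_ac)
  ultimately show ?thesis unfolding k_def[symmetric]
    by (auto simp: vertex_line_def tangent_line_def affine_part_def frechet_derivative_isogonal_form
        line_dir_eq simp del: complex_cnj_mult times_complex.sel)
qed

theorem opposite_vertices_isogonal_conjugates: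
  assumes q: "quadrilateral a b c d"
  shows "isogonal_conjugates a b c d (fin_pt a) (fin_pt c)"
proof -
  have ne: "a \<noteq> b" "b \<noteq> a" "a \<noteq> c" "c \<noteq> a" "a \<noteq> d" "d \<noteq> a"
    "b \<noteq> c" "c \<noteq> b" "b \<noteq> d" "d \<noteq> b" "c \<noteq> d" "d \<noteq> c"
    using q by (auto simp: quadrilateral_def)
  have rp: "fin_pt y \<in> RP2" for y
    by (simp add: RP2_def fin_pt_def dim_span_singleton zero_prod_def)
  have tan: "isogonal a (vertex_line a b c d a (fin_pt a)) (line_dir a (c - a))
      (line_dir a (b - a)) (line_dir a (d - a))" if q: "quadrilateral a b c d" for a b c d
  proof -
    have "Im ((a - b) * (a - d) * cnj (a - c) * (c - a) * cnj ((b - a) * (d - a))) = 0"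
    proof -
      have "(a - b) * (a - d) * cnj (a - c) * (c - a) * cnj ((b - a) * (d - a)) =
          - (((a - b) * (a - d) * (a - c)) * cnj ((a - b) * (a - d) * (a - c)))"
        by (simp add: algebra_simps)
      also have "Im \<dots> = 0" by (simp only: complex_mult_cnj uminus_complex.sel Im_complex_of_real)
      finally show ?thesis .
    qed
    then show ?thesis unfolding vertex_line_tangent[OF q] using q
      by (subst isogonal_line_dir) (auto simp: quadrilateral_def)
  qed
  have "quadrilateral c b a d" using q by (auto simp: quadrilateral_def)
  from tan[OF this] have c: "isogonal c (vertex_line a b c d c (fin_pt c)) (line_dir c (a - c))
      (line_dir c (b - c)) (line_dir c (d - c))"
    by (simp add: vertex_line_def isogonal_form_swap)
  have isosym: "isogonal x l l' m m' \<Longrightarrow> isogonal x l' l m m'"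
    if "l' = line_dir x u'" "l = line_dir x u" "u \<noteq> 0" "u' \<noteq> 0" for x l l' m m' u u'
    using that unfolding isogonal_def by (simp add: angle_bisectors_line_dir mult.commute)
  have "vertex_line a b c d c (fin_pt c) = line_dir c ((c - b) * (c - d) * cnj (c - a))"
    using vertex_line_tangent[OF \<open>quadrilateral c b a d\<close>]
    by (simp add: vertex_line_def isogonal_form_swap)
  then have "isogonal c (line_dir c (a - c)) (vertex_line a b c d c (fin_pt c))
      (line_dir c (b - c)) (line_dir c (d - c))"
    using ne by (intro isosym[OF refl _ _ _ c]) auto
  moreover have "isogonal d (line_dir d (a - d)) (line_dir d (c - d)) (line_dir d (c - d)) (line_dir d (a - d))"
    using ne unfolding isogonal_def by (simp add: angle_bisectors_line_dir mult.commute)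
  ultimately show ?thesis
    unfolding isogonal_conjugates_def Let_def using tan[OF q] ne rp
    by (simp add: vertex_line_other) (simp add: isogonal_def)
qed

end

theory Submission
  imports Defs "HOL-Real_Asymp.Real_Asymp"
begin

text \<open>
  Put \<open>R(z) = (z - b)(z - d) / ((z - a)(z - c))\<close>. The finite points of the isogonal cubic are those
  with \<open>R(z)\<close> real, and isogonal conjugation is the deck involution of the double cover \<open>R\<close>, i.e. the
  Moebius involution \<open>(x - f)(x' - f) = m\<close> that exchanges \<open>a, c\<close> as well as \<open>b, d\<close>; it exchanges the
  focus \<open>f\<close> with the real point at infinity. In the coordinate \<open>\<zeta> = (z - f) / s\<close>, where
  \<open>s = a + c - b - d\<close>, the cubic is \<open>\<bar>\<zeta>\<bar>\<^sup>2 (Im \<zeta> - k) + Im (n cnj \<zeta>) = 0\<close> with \<open>n = m / s\<^sup>2\<close>.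

  Two such equations of the same point set agree in their cubic terms, so their difference is a conic
  through every point of the cubic. If this conic did not vanish identically, eliminating one
  coordinate would confine the points of the cubic to finitely many parallel lines, so the cubic would
  contain a line, against irreducibility. Hence \<open>f\<close> and \<open>m\<close> depend on the cubic only.
\<close>

section \<open>Irreducible cubics contain no line\<close>

text \<open>Evaluation at \<open>y\<close> and \<open>z\<close> is a ring homomorphism, so
  \<open>l\<close> may be replaced by any polynomial, for instance a constant, with the same value
  there.\<close>

lemma poly_poly_eval_cong:
  fixes F :: "real poly poly poly"
  assumes "poly (poly l [:y:]) z = poly (poly l' [:y:]) z"
  shows "poly (poly (poly F l) [:y:]) z = poly (poly (poly F l') [:y:]) z"
  using assms by (induction F) simp_all

lemma poly_eval_cong:
  fixes F :: "real poly poly"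
  assumes "poly l z = poly l' z"
  shows "poly (poly F l) z = poly (poly F l') z"
  using assms by (induction F) simp_all

text \<open>In this form, vanishing for all \<open>x\<close> kills every coefficient
  separately.\<close>

lemma eval3_as_poly:
  "eval3 F (Complex x y, z) = poly (map_poly (\<lambda>h. poly (poly h [:y:]) z) F) x"
  by (induction F) (simp_all add: eval3_def map_poly_pCons)

lemma poly_poly_all_zero:
  fixes h :: "real poly poly"
  assumes "\<And>y z. poly (poly h [:y:]) z = 0"
  shows "h = 0"
proof (rule ccontr)
  assume "h \<noteq> 0"
  then have "finite {p. poly h p = 0}" by (rule poly_roots_finite)
  moreover have "range (\<lambda>y. [:y:]) \<subseteq> {p. poly h p = 0}"
    using assms by (auto simp: poly_eq_poly_eq_iff[symmetric])
  moreover have "infinite (range (\<lambda>y::real. [:y:]))"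
    by (subst finite_image_iff) (auto simp: inj_on_def infinite_UNIV_char_0)
  ultimately show False using finite_subset by blast
qed

text \<open>The cofactor of \<open>l\<close> is a unit, hence a nonzero real constant, so
  \<open>F\<close> would inherit from \<open>l\<close> a monomial of degree other than 3.\<close>

lemma irreducible_cubic_no_linear_factor:
  assumes "homogeneous 3 F" "irreducible F" "l dvd F" "\<not> l dvd 1"
    and "coeff (coeff (coeff l i) j) k \<noteq> 0" "i + j + k \<noteq> 3"
  shows False
proof -
  obtain Q where Q: "F = l * Q" using assms(3) by blast
  then have "Q dvd 1" using assms(2,4) by (auto dest: irreducibleD)
  then obtain e where e: "Q = [:[:[:e:]:]:]" "e dvd 1"
    by (auto simp: is_unit_poly_iff)
  then have "e \<noteq> 0" by auto
  then have "F = smult [:[:e:]:] l" unfolding Q e(1) by simp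
  then have "coeff (coeff (coeff F i) j) k = e * coeff (coeff (coeff l i) j) k" by simp
  then show False using assms(1,5,6) \<open>e \<noteq> 0\<close> by (auto simp: homogeneous_def)
qed

text \<open>The triple \<open>(0, 0, r)\<close> describes the line at infinity.\<close>

definition contains_no_line :: "(complex \<times> real) set set \<Rightarrow> bool" where
  "contains_no_line K \<longleftrightarrow> (\<forall>p q r. (p, q, r) \<noteq> (0, 0, 0) \<longrightarrow>
     (\<exists>w t. (w, t) \<noteq> 0 \<and> p * Re w + q * Im w + r * t = 0 \<and> span {(w, t)} \<notin> K))"

text \<open>If the cubic contained a line, the linear form of the line would divide
  \<open>F\<close>: the factor theorem applies in the first of the three variables whose coefficient
  \<open>p\<close>, \<open>q\<close> or \<open>r\<close> is nonzero.\<close>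

lemma nondegenerate_cubic_contains_no_line:
  assumes "nondegenerate_cubic K"
  shows "contains_no_line K"
  unfolding contains_no_line_def
proof (intro allI impI, rule ccontr)
  fix p q r :: real
  assume pqr: "(p, q, r) \<noteq> (0, 0, 0)" and
    "\<not> (\<exists>w t. (w, t) \<noteq> 0 \<and> p * Re w + q * Im w + r * t = 0 \<and> span {(w, t)} \<notin> K)"
  then have line: "span {(w, t)} \<in> K" if "(w, t) \<noteq> 0" "p * Re w + q * Im w + r * t = 0" for w t
    using that by blast
  obtain F where F: "homogeneous 3 F" "irreducible F" and K: "K = zero_locus (eval3 F)"
    using assms by (auto simp: nondegenerate_cubic_def)
  \<comment> \<open>Projective points give information on nonzero vectors only. One point of the
    line is used to see that the form vanishes at the origin too.\<close>
  have "(\<exists>w t. (w, t) \<noteq> 0 \<and> p * Re w + q * Im w + r * t = 0)"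
  proof (cases "p = 0 \<and> q = 0")
    case True
    then show ?thesis by (intro exI[of _ 1] exI[of _ 0]) (simp add: zero_prod_def)
  next
    case False
    then show ?thesis
      by (intro exI[of _ "Complex (-q) p"] exI[of _ 0]) (auto simp: zero_prod_def complex_eq_iff)
  qed
  then obtain u :: "complex \<times> real" where "span {u} \<in> K" using line by auto
  then have "eval3 F 0 = 0" unfolding K zero_locus_def by (auto intro: span_0)
  moreover have "eval3 F (w, t) = 0" if "(w, t) \<noteq> 0" "p * Re w + q * Im w + r * t = 0" for w t
    using line[OF that] unfolding K zero_locus_def by (auto intro: span_base)
  ultimately have ev: "eval3 F (Complex x y, z) = 0" if "p * x + q * y + r * z = 0" for x y z
    using that by (cases "(Complex x y, z) = 0") auto
  consider "p \<noteq> 0" | "p = 0" "q \<noteq> 0" | "p = 0" "q = 0" "r \<noteq> 0" using pqr by auto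
  then show False
  proof cases
    case 1
    \<comment> \<open>The equation of the line solved for the first variable, as a polynomial in the
      second one over polynomials in the third.\<close>
    define l where "l = [:[:0, - r / p:], [:- q / p:]:]"
    have "poly (poly (poly F l) [:y:]) z = 0" for y z
    proof -
      define x where "x = - r / p * z - q / p * y"
      have "poly (poly (poly F l) [:y:]) z = poly (poly (poly F [:[:x:]:]) [:y:]) z"
        by (rule poly_poly_eval_cong) (simp add: l_def x_def)
      also have "\<dots> = eval3 F (Complex x y, z)" by (simp add: eval3_def)
      also have "\<dots> = 0" using 1 by (intro ev) (simp add: x_def field_simps)
      finally show ?thesis .
    qed
    then have "poly F l = 0" by (rule poly_poly_all_zero)
    then have "[:- l, 1:] dvd F" by (simp add: poly_eq_0_iff_dvd)
    then show False
      by (rule irreducible_cubic_no_linear_factor[OF F, where i=1 and j=0 and k=0])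
        (auto simp: is_unit_poly_iff)
  next
    case 2
    define l where "l = [:0, - r / q:]"
    have "poly (coeff F i) l = 0" for i
    proof -
      have "poly (poly (coeff F i) l) z = 0" for z
      proof -
        define y where "y = - r / q * z"
        have "poly (map_poly (\<lambda>h. poly (poly h [:y:]) z) F) x = 0" for x
          unfolding eval3_as_poly[symmetric] using 2 by (intro ev) (simp add: y_def)
        then have "map_poly (\<lambda>h. poly (poly h [:y:]) z) F = 0"
          using poly_all_0_iff_0 by blast
        then have "poly (poly (coeff F i) [:y:]) z = 0"
          by (metis (mono_tags, lifting) coeff_0 coeff_map_poly poly_0)
        moreover have "poly (poly (coeff F i) l) z = poly (poly (coeff F i) [:y:]) z"
          by (rule poly_eval_cong) (simp add: l_def y_def)
        ultimately show ?thesis by simp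
      qed
      then show ?thesis using poly_all_0_iff_0 by blast
    qed
    then have "[:[:- l, 1:]:] dvd F" by (simp add: const_poly_dvd_iff poly_eq_0_iff_dvd)
    then show False
      by (rule irreducible_cubic_no_linear_factor[OF F, where i=0 and j=1 and k=0])
        (auto simp: is_unit_poly_iff)
  next
    case 3
    have "coeff (coeff (coeff F i) j) 0 = 0" for i j
    proof -
      have "poly (map_poly (\<lambda>g. poly g 0) (coeff F i)) y = 0" for y
      proof -
        have "poly (map_poly (\<lambda>h. poly (poly h [:y:]) 0) F) x = 0" for x
          unfolding eval3_as_poly[symmetric] using 3 by (intro ev) simp
        then have "map_poly (\<lambda>h. poly (poly h [:y:]) 0) F = 0"
          using poly_all_0_iff_0 by blast
        then have "poly (poly (coeff F i) [:y:]) 0 = 0"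
          by (metis (mono_tags, lifting) coeff_0 coeff_map_poly poly_0)
        moreover have "poly (map_poly (\<lambda>g. poly g 0) h) y = poly (poly h [:y:]) 0" for h
          by (induction h) (simp_all add: map_poly_pCons)
        ultimately show ?thesis by simp
      qed
      then have "map_poly (\<lambda>g. poly g 0) (coeff F i) = 0"
        using poly_all_0_iff_0 by blast
      then have "poly (coeff (coeff F i) j) 0 = 0"
        by (metis (mono_tags, lifting) coeff_0 coeff_map_poly poly_0)
      then show ?thesis by (simp add: poly_0_coeff_0)
    qed
    then have "[:0, 1:] dvd coeff (coeff F i) j" for i j
      using poly_eq_0_iff_dvd[of "coeff (coeff F i) j" 0] by (simp add: poly_0_coeff_0)
    then have "[:[:[:0, 1:]:]:] dvd F" by (simp add: const_poly_dvd_iff)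
    then show False
      by (rule irreducible_cubic_no_linear_factor[OF F, where i=0 and j=0 and k=1])
        (auto simp: is_unit_poly_iff)
  qed
qed

section \<open>Uniqueness of the normal form\<close>

text \<open>For every \<open>y\<close> there is a point \<open>(X y, y)\<close> on the cubic. Its
  behaviour along the asymptote removes \<open>q3\<close> and couples \<open>q2\<close> with
  \<open>q5\<close>; eliminating \<open>y\<close> then leaves polynomials with all
  \<open>X y\<close> as roots, which must be zero by \<open>no_line\<close>.\<close>

lemma conic_through_circular_cubic:
  fixes k \<alpha> \<beta> :: real
  assumes Q: "\<And>x y. (x\<^sup>2 + y\<^sup>2) * (x - k) + \<beta> * y - \<alpha> * x = 0 \<Longrightarrow>
      q1 * x\<^sup>2 + q2 * x * y + q3 * y\<^sup>2 + q4 * x + q5 * y + q6 = 0"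
    and no_line: "\<And>x. \<exists>y. (x\<^sup>2 + y\<^sup>2) * (x - k) + \<beta> * y - \<alpha> * x \<noteq> 0"
  shows "q1 = 0" "q2 = 0" "q3 = 0" "q4 = 0" "q5 = 0" "q6 = 0"
proof -
  \<comment> \<open>For fixed \<open>y\<close> this is a monic cubic in \<open>x\<close>.\<close>
  have ex: "\<exists>x. (x\<^sup>2 + y\<^sup>2) * (x - k) + \<beta> * y - \<alpha> * x = 0" for y
  proof -
    define g where "g x = (x\<^sup>2 + y\<^sup>2) * (x - k) + \<beta> * y - \<alpha> * x" for x
    have "filterlim g at_top at_top" "filterlim g at_bot at_bot"
      unfolding g_def by real_asymp+
    then have "eventually (\<lambda>x. g x > 0) at_top" "eventually (\<lambda>x. g x < 0) at_bot"
      by (auto simp: filterlim_at_top_dense filterlim_at_bot_dense)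
    then obtain u v where uv: "\<And>x. x \<ge> u \<Longrightarrow> g x > 0" "\<And>x. x \<le> v \<Longrightarrow> g x < 0"
      by (auto simp: eventually_at_top_linorder eventually_at_bot_linorder)
    have "\<exists>x\<ge>min u v. x \<le> max u v \<and> g x = 0"
      using uv[of "max u v"] uv(2)[of "min u v"]
      by (intro IVT) (auto simp: g_def less_imp_le intro!: continuous_intros)
    then show ?thesis by (auto simp: g_def)
  qed
  then obtain X where X: "\<And>y. ((X y)\<^sup>2 + y\<^sup>2) * (X y - k) + \<beta> * y - \<alpha> * X y = 0" by metis
  have Q': "q1 * (X y)\<^sup>2 + q2 * X y * y + q3 * y\<^sup>2 + q4 * X y + q5 * y + q6 = 0" for y
    using Q X by blast
  \<comment> \<open>Otherwise \<open>X\<close> has finite range and takes some value infinitely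
    often, so the cubic contains the line of points with that first coordinate.\<close>
  have poly_zero: "P = 0" if P: "\<And>y. poly P (X y) = 0" for P
  proof (rule ccontr)
    assume "P \<noteq> 0"
    then have "finite {x. poly P x = 0}" by (rule poly_roots_finite)
    then have "finite (range X)" using P by (auto elim: finite_subset[rotated])
    then obtain y0 where y0: "infinite {y. X y = X y0}"
      using pigeonhole_infinite[of "UNIV :: real set" X] by (auto simp: infinite_UNIV_char_0)
    define x where "x = X y0"
    define L where "L = [:x\<^sup>2 * (x - k) - \<alpha> * x, \<beta>, x - k:]"
    have L: "poly L y = (x\<^sup>2 + y\<^sup>2) * (x - k) + \<beta> * y - \<alpha> * x" for y
      by (simp add: L_def power2_eq_square algebra_simps)
    have "{y. X y = X y0} \<subseteq> {y. poly L y = 0}"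
      using X by (auto simp: L x_def) metis
    then have "L = 0" using y0 poly_roots_finite finite_subset by blast
    then show False using no_line[of x] L by auto
  qed
  \<comment> \<open>The line \<open>x = k\<close> is the real asymptote.\<close>
  have lim: "(\<lambda>n. X (real n)) \<longlonglongrightarrow> k"
  proof -
    have "(\<lambda>n. X (real n) - k) \<longlonglongrightarrow> 0"
    proof (rule Lim_null_comparison)
      show "(\<lambda>n. (\<bar>\<beta>\<bar> + \<bar>\<alpha>\<bar>) / real n) \<longlonglongrightarrow> 0" by real_asymp
      show "\<forall>\<^sub>F n in sequentially. norm (X (real n) - k) \<le> (\<bar>\<beta>\<bar> + \<bar>\<alpha>\<bar>) / real n"
        using eventually_gt_at_top[of 0]
      proof eventually_elim
        case (elim n)
        define y where "y = real n"
        have y: "y > 0" using elim by (simp add: y_def)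
        have "\<bar>X y\<bar> * y \<le> (X y)\<^sup>2 + y\<^sup>2"
        proof -
          have "0 \<le> \<bar>X y\<bar> * y" using y by simp
          then show ?thesis using sum_squares_bound[of "\<bar>X y\<bar>" y] unfolding power2_abs by linarith
        qed
        \<comment> \<open>After multiplication by \<open>y\<close>, both terms on the right are
          bounded by multiples of \<open>(X y)\<^sup>2 + y\<^sup>2\<close>. This factor cancels and
          leaves a bound of order 1 / \<open>y\<close>.\<close>
        have "\<bar>X y - k\<bar> * ((X y)\<^sup>2 + y\<^sup>2) = \<bar>((X y)\<^sup>2 + y\<^sup>2) * (X y - k)\<bar>"
          by (simp add: abs_mult)
        also have "\<dots> = \<bar>\<alpha> * X y - \<beta> * y\<bar>"
          using X[of y] by (simp add: algebra_simps)
        also have "\<dots> \<le> \<bar>\<alpha>\<bar> * \<bar>X y\<bar> + \<bar>\<beta>\<bar> * y"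
          using y abs_triangle_ineq4[of "\<alpha> * X y" "\<beta> * y"] by (simp add: abs_mult)
        finally have "\<bar>X y - k\<bar> * ((X y)\<^sup>2 + y\<^sup>2) * y \<le> (\<bar>\<alpha>\<bar> * \<bar>X y\<bar> + \<bar>\<beta>\<bar> * y) * y"
          using y by (intro mult_right_mono) auto
        also have "\<dots> = \<bar>\<alpha>\<bar> * (\<bar>X y\<bar> * y) + \<bar>\<beta>\<bar> * y\<^sup>2"
          by (simp add: power2_eq_square algebra_simps)
        also have "\<dots> \<le> \<bar>\<alpha>\<bar> * ((X y)\<^sup>2 + y\<^sup>2) + \<bar>\<beta>\<bar> * ((X y)\<^sup>2 + y\<^sup>2)"
          using \<open>\<bar>X y\<bar> * y \<le> (X y)\<^sup>2 + y\<^sup>2\<close> by (intro add_mono mult_left_mono) auto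
        finally have "(\<bar>X y - k\<bar> * y) * ((X y)\<^sup>2 + y\<^sup>2) \<le> (\<bar>\<beta>\<bar> + \<bar>\<alpha>\<bar>) * ((X y)\<^sup>2 + y\<^sup>2)"
          by (simp add: algebra_simps)
        moreover have "(X y)\<^sup>2 + y\<^sup>2 > 0" using y by (simp add: add_nonneg_pos)
        ultimately have "\<bar>X y - k\<bar> * y \<le> \<bar>\<beta>\<bar> + \<bar>\<alpha>\<bar>" by simp
        then show ?case using y unfolding y_def by (simp add: field_simps)
      qed
    qed
    then show ?thesis by (simp add: LIM_zero_iff)
  qed
  define e where "e n = 1 / real n" for n
  have e0: "e \<longlonglongrightarrow> 0" unfolding e_def by real_asymp
  show q3: "q3 = 0"
  proof -
    \<comment> \<open>The conic at \<open>(X n, n)\<close> divided by \<open>n\<^sup>2\<close>; its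
      limit is \<open>q3\<close>.\<close>
    define s where "s n = q1 * (X n)\<^sup>2 * (e n)\<^sup>2 + q2 * X n * e n + q3 + q4 * X n * (e n)\<^sup>2
        + q5 * e n + q6 * (e n)\<^sup>2" for n
    have "s \<longlonglongrightarrow> q1 * k\<^sup>2 * 0\<^sup>2 + q2 * k * 0 + q3 + q4 * k * 0\<^sup>2 + q5 * 0 + q6 * 0\<^sup>2"
      unfolding s_def by (intro tendsto_intros lim e0)
    moreover have "\<forall>\<^sub>F n in sequentially. s n = 0"
      using eventually_gt_at_top[of 0]
    proof eventually_elim
      case (elim n)
      have "s n = (q1 * (X n)\<^sup>2 + q2 * X n * real n + q3 * (real n)\<^sup>2 + q4 * X n + q5 * real n + q6)
          * (e n)\<^sup>2"
        using elim by (simp add: s_def e_def power2_eq_square field_simps)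
      then show ?case using Q' by simp
    qed
    then have "s \<longlonglongrightarrow> 0" by (rule tendsto_eventually)
    ultimately have "q3 = 0" using LIMSEQ_unique by fastforce
    then show ?thesis .
  qed
  have q25: "q2 * k + q5 = 0"
  proof -
    \<comment> \<open>With \<open>q3 = 0\<close>, dividing the conic by \<open>n\<close> only
      suffices for convergence.\<close>
    define s where "s n = q1 * (X n)\<^sup>2 * e n + q2 * X n + q4 * X n * e n + q5 + q6 * e n" for n
    have "s \<longlonglongrightarrow> q1 * k\<^sup>2 * 0 + q2 * k + q4 * k * 0 + q5 + q6 * 0"
      unfolding s_def by (intro tendsto_intros lim e0)
    moreover have "\<forall>\<^sub>F n in sequentially. s n = 0"
      using eventually_gt_at_top[of 0]
    proof eventually_elim
      case (elim n)
      have "s n = (q1 * (X n)\<^sup>2 + q2 * X n * real n + q3 * (real n)\<^sup>2 + q4 * X n + q5 * real n + q6)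
          * e n"
        using elim by (simp add: s_def e_def q3 field_simps)
      then show ?case using Q' by simp
    qed
    then have "s \<longlonglongrightarrow> 0" by (rule tendsto_eventually)
    ultimately have "q2 * k + q5 = 0" using LIMSEQ_unique by fastforce
    then show ?thesis .
  qed
  show q2: "q2 = 0"
  proof (rule ccontr)
    assume "q2 \<noteq> 0"
    \<comment> \<open>The conic now reads \<open>q2 (x - k) y = - A(x)\<close>; inserting this into the equation of the cubic,
      multiplied by \<open>q2\<^sup>2 (x - k)\<close>, eliminates \<open>y\<close>.\<close>
    define A where "A = [:q6, q4, q1:]"
    define P where "P = smult (q2\<^sup>2) ([:0, 0, 1:] * [:-k, 1:] * [:-k, 1:]) + A * A
        - smult (\<beta> * q2) A - smult (\<alpha> * q2\<^sup>2) ([:0, 1:] * [:-k, 1:])"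
    have "poly P (X y) = 0" for y
    proof -
      define x where "x = X y"
      have 1: "q2 * (x - k) * y = - poly A x"
        using Q'[of y] q25 q3 unfolding x_def A_def by (simp add: power2_eq_square) algebra
      have 2: "(x\<^sup>2 + y\<^sup>2) * (x - k) + \<beta> * y - \<alpha> * x = 0" using X by (simp add: x_def)
      have "poly P x = q2\<^sup>2 * (x\<^sup>2 * (x - k) * (x - k)) + (- poly A x)\<^sup>2 + \<beta> * q2 * (- poly A x)
          - \<alpha> * q2\<^sup>2 * (x * (x - k))"
        by (simp add: P_def power2_eq_square algebra_simps)
      also have "\<dots> = q2\<^sup>2 * (x - k) * ((x\<^sup>2 + y\<^sup>2) * (x - k) + \<beta> * y - \<alpha> * x)"
        unfolding 1[symmetric] by (simp add: power2_eq_square algebra_simps)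
      finally show ?thesis using 2 by (simp add: x_def)
    qed
    then have "P = 0" by (rule poly_zero)
    \<comment> \<open>Only the first summand and \<open>A * A\<close> reach degree 4; they
      contribute \<open>q2\<^sup>2\<close> and \<open>q1\<^sup>2\<close>.\<close>
    then have "coeff P 4 = 0" by simp
    then have "q2\<^sup>2 + q1\<^sup>2 = 0"
      by (simp add: P_def A_def eval_nat_numeral)
    then show False using \<open>q2 \<noteq> 0\<close> by (simp add: sum_power2_eq_zero_iff)
  qed
  show q5: "q5 = 0" using q25 q2 by simp
  have "[:q6, q4, q1:] = 0"
    using Q' by (intro poly_zero) (simp add: q2 q3 q5 power2_eq_square algebra_simps)
  then show "q1 = 0" "q4 = 0" "q6 = 0" by auto
qed

text \<open>Normal form of a circular cubic that passes through its singular focus, placed at 0, and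
  has its real point at infinity on the real axis.\<close>

definition circular_cubic :: "real \<Rightarrow> complex \<Rightarrow> complex \<Rightarrow> real" where
  "circular_cubic k n z = (cmod z)\<^sup>2 * (Im z - k) + Im (n * cnj z)"

text \<open>The two equations have the same cubic terms, so their difference is a conic through the
  curve and vanishes identically. Its quadratic coefficients give \<open>g = 0\<close>, its linear
  ones then \<open>n' = n\<close>.\<close>

lemma circular_cubic_unique:
  assumes sub: "\<And>z. circular_cubic k n z = 0 \<Longrightarrow> circular_cubic k' n' (z - g) = 0"
    and no_line: "\<And>x. \<exists>y. circular_cubic k n (Complex y x) \<noteq> 0"
  shows "g = 0" "n' = n"
proof -
  let ?e = "Im g + k'"
  \<comment> \<open>The coordinates are exchanged, so that \<open>x\<close> is the imaginary part
    and the asymptote becomes \<open>x = k\<close>.\<close>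
  have form: "circular_cubic k n (Complex y x) =
      (x\<^sup>2 + y\<^sup>2) * (x - k) + Im n * y - Re n * x" for x y k n
    by (simp add: circular_cubic_def cmod_power2 algebra_simps)
  have "(k - ?e - 2 * Im g) * x\<^sup>2 + (- 2 * Re g) * x * y + (k - ?e) * y\<^sup>2
      + ((Im g)\<^sup>2 + (Re g)\<^sup>2 + 2 * Im g * ?e - Re n' + Re n) * x + (2 * Re g * ?e + Im n' - Im n) * y
      + (- ?e * ((Im g)\<^sup>2 + (Re g)\<^sup>2) - Im n' * Re g + Re n' * Im g) = 0"
    if "(x\<^sup>2 + y\<^sup>2) * (x - k) + Im n * y - Re n * x = 0" for x y
  proof -
    have "circular_cubic k' n' (Complex (y - Re g) (x - Im g)) = 0"
      using sub[of "Complex y x"] that by (simp add: form complex_diff[symmetric] complex_surj)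
    then show ?thesis using that unfolding form by (simp add: power2_eq_square algebra_simps)
  qed
  note Q = conic_through_circular_cubic[OF this no_line[unfolded form]]
  have "Re g = 0" using Q(2) by simp
  moreover have "Im g = 0" using Q(1,3) by simp
  ultimately show "g = 0" by (simp add: complex_eq_iff)
  then show "n' = n" using Q(4,5) by (simp add: complex_eq_iff)
qed

section \<open>Isogonality in terms of directions\<close>

lemma RP2_E:
  assumes "X \<in> RP2"
  obtains v where "v \<noteq> 0" "X = span {v}"
proof -
  have X: "subspace X" "dim X = 1" using assms by (auto simp: RP2_def)
  obtain B where B: "B \<subseteq> X" "independent B" "X \<subseteq> span B" "card B = dim X"
    using basis_exists[of X] by blast
  then obtain v where v: "B = {v}" using X(2) by (auto simp: card_1_singleton_iff)
  have "span {v} = X" using B X(1) v by (metis span_eq_iff span_mono subset_antisym)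
  moreover have "v \<noteq> 0" using B(2) v dependent_zero by blast
  ultimately show ?thesis using that by blast
qed

lemma span_scaleR_singleton: "k \<noteq> 0 \<Longrightarrow> span {k *\<^sub>R v} = span {v}"
  for v :: "'a :: real_vector"
proof -
  assume k: "k \<noteq> 0"
  then have "v = (1 / k) *\<^sub>R k *\<^sub>R v" by simp
  then have "v \<in> span {k *\<^sub>R v}" by (metis insertI1 span_base span_scale)
  moreover have "k *\<^sub>R v \<in> span {v}" by (simp add: span_base span_scale)
  ultimately show ?thesis by (simp add: span_eq)
qed

lemma span_Pair_eq_fin_pt: "t \<noteq> 0 \<Longrightarrow> span {(w, t)} = fin_pt (w / of_real t)"
proof -
  assume t: "t \<noteq> 0"
  have "(w, t) = t *\<^sub>R (w / of_real t, 1)" using t by (simp add: scaleR_conv_of_real)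
  then show ?thesis using t by (metis span_scaleR_singleton fin_pt_def)
qed

lemma span_Pair_eq_fin_pt_iff:
  assumes "v \<noteq> 0"
  shows "span {v} = fin_pt a \<longleftrightarrow> fst v = of_real (snd v) * a"
proof
  assume "span {v} = fin_pt a"
  then have "v \<in> span {(a, 1)}" by (metis fin_pt_def insertI1 span_base)
  then show "fst v = of_real (snd v) * a" by (auto simp: span_singleton scaleR_conv_of_real)
next
  assume v: "fst v = of_real (snd v) * a"
  then have "snd v \<noteq> 0" using assms by (auto simp: prod_eq_iff)
  then show "span {v} = fin_pt a" using v span_Pair_eq_fin_pt[of "snd v" "fst v"] by (cases v) simp
qed

lemma span_eq_if_cross_zero:
  fixes w w' :: complex and t t' :: real
  assumes nz: "(w, t) \<noteq> 0" "(w', t') \<noteq> 0"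
    and cross: "Im w * t' = t * Im w'" "t * Re w' = Re w * t'" "Re w * Im w' = Im w * Re w'"
  shows "span {(w, t)} = span {(w', t')}"
proof -
  have "\<exists>k. (w', t') = k *\<^sub>R (w, t)"
  proof -
    consider "Re w \<noteq> 0" | "Im w \<noteq> 0" | "t \<noteq> 0"
      using nz(1) by (auto simp: zero_prod_def complex_eq_iff)
    then show ?thesis
    proof cases
      case 1
      then show ?thesis using cross
        by (intro exI[of _ "Re w' / Re w"]) (simp add: complex_eq_iff field_simps)
    next
      case 2
      then show ?thesis using cross
        by (intro exI[of _ "Im w' / Im w"]) (simp add: complex_eq_iff field_simps)
    next
      case 3
      then show ?thesis using cross
        by (intro exI[of _ "t' / t"]) (simp add: complex_eq_iff field_simps)
    qed
  qed
  then obtain k where "(w', t') = k *\<^sub>R (w, t)" by blast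
  moreover from this have "k \<noteq> 0" using nz(2) by (auto simp: zero_prod_def)
  ultimately show ?thesis by (metis span_scaleR_singleton)
qed

section \<open>Relabelling the vertices and isogonality at one vertex\<close>

text \<open>Rotating the labels exchanges \<open>r\<close> and \<open>s\<close>, which conjugates
  the expression under \<open>Im\<close>.\<close>

lemma isogonal_form_rotate: "isogonal_form b c d a v = - isogonal_form a b c d v"
  by (cases v) (simp add: isogonal_form_def Let_def power2_eq_square algebra_simps)

lemma isogonal_cubic_rotate: "isogonal_cubic b c d a = isogonal_cubic a b c d"
  by (simp add: isogonal_cubic_def zero_locus_def isogonal_form_rotate[of b c d a])

lemma isogonal_form_differentiable: "isogonal_form a b c d differentiable (at v)"
proof -
  have "isogonal_form a b c d = (\<lambda>p.
     let r = (b + d) * fst p - b * d * of_real (snd p);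
         s = (a + c) * fst p - a * c * of_real (snd p)
     in Im (of_real (snd p) * r * cnj s - r * cnj (fst p ^ 2) - fst p ^ 2 * cnj s))"
    by (simp add: isogonal_form_def case_prod_unfold)
  then show ?thesis
    unfolding Let_def differentiable_def
    apply (simp only:)
    apply (rule exI)
    apply (rule derivative_eq_intros bounded_linear.has_derivative[OF bounded_linear_Im]
      bounded_linear.has_derivative[OF bounded_linear_cnj]
      bounded_linear.has_derivative[OF bounded_linear_of_real] refl)+
    done
qed

text \<open>Only the tangent depends on the labels. Since the form merely changes sign, its
  derivative keeps the same kernel.\<close>

lemma vertex_line_rotate: "vertex_line b c d a u X = vertex_line a b c d u X"
proof -
  have F: "isogonal_form b c d a = (\<lambda>v. - isogonal_form a b c d v)"
    by (rule ext) (rule isogonal_form_rotate)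
  have "(isogonal_form b c d a has_derivative
      (\<lambda>x. - frechet_derivative (isogonal_form a b c d) (at v) x)) (at v)" for v
    unfolding F
    by (intro has_derivative_minus frechet_derivative_works[THEN iffD1] isogonal_form_differentiable)
  then have "frechet_derivative (isogonal_form b c d a) (at v) =
      (\<lambda>x. - frechet_derivative (isogonal_form a b c d) (at v) x)" for v
    by (metis frechet_derivative_at)
  then show ?thesis by (simp add: vertex_line_def tangent_line_def)
qed

text \<open>
  The direction of the line from the vertex \<open>a\<close> (with neighbours \<open>b\<close>, \<open>d\<close> and opposite vertex \<open>c\<close>)
  to the point \<open>span {v}\<close>; the first branch is the tangent at \<open>a\<close>.
\<close>

definition vertex_dir :: "complex \<Rightarrow> complex \<Rightarrow> complex \<Rightarrow> complex \<Rightarrow> complex \<times> real \<Rightarrow> complex" where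
  "vertex_dir a b c d v =
     (if fst v = of_real (snd v) * a then (a - b) * (a - d) * cnj (a - c)
      else fst v - of_real (snd v) * a)"

lemma vertex_dir_nonzero: "quadrilateral a b c d \<Longrightarrow> vertex_dir a b c d v \<noteq> 0"
  by (auto simp: vertex_dir_def quadrilateral_def)

lemma vertex_line_eq_line_dir:
  assumes "quadrilateral a b c d" "v \<noteq> 0"
  shows "vertex_line a b c d a (span {v}) = line_dir a (vertex_dir a b c d v)"
proof (cases "fst v = of_real (snd v) * a")
  case True
  then have "span {v} = fin_pt a" using span_Pair_eq_fin_pt_iff[OF assms(2)] by simp
  then show ?thesis using vertex_line_tangent[OF assms(1)] True by (simp add: vertex_dir_def)
next
  case False
  then show ?thesis using span_Pair_eq_fin_pt_iff[OF assms(2)]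
    by (simp add: vertex_dir_def vertex_line_def affine_part_line_through)
qed

text \<open>The criterion \<open>isogonal_line_dir\<close> at the vertex \<open>a\<close> alone; the
  other vertices are reached by rotating the labels.\<close>

definition isogonal_at ::
    "complex \<Rightarrow> complex \<Rightarrow> complex \<Rightarrow> complex \<Rightarrow> complex \<times> real \<Rightarrow> complex \<times> real \<Rightarrow> bool" where
  "isogonal_at a b c d v v' \<longleftrightarrow>
     Im (vertex_dir a b c d v * vertex_dir a b c d v' * cnj ((b - a) * (d - a))) = 0"

lemma isogonal_at_sym: "isogonal_at a b c d v v' \<longleftrightarrow> isogonal_at a b c d v' v"
  unfolding isogonal_at_def by (subst mult.commute[of "vertex_dir a b c d v"]) (rule refl)

lemma isogonal_vertex_lines_iff:
  assumes q: "quadrilateral a b c d" and "v \<noteq> 0" "v' \<noteq> 0"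
  defines "L \<equiv> vertex_line a b c d a"
  shows "isogonal a (L (span {v})) (L (span {v'})) (L (fin_pt b)) (L (fin_pt d))
           \<longleftrightarrow> isogonal_at a b c d v v'"
    and "isogonal a (L (span {v})) (L (span {v'})) (L (fin_pt d)) (L (fin_pt b))
           \<longleftrightarrow> isogonal_at a b c d v v'"
proof -
  have "a \<noteq> b" "a \<noteq> d" using q by (auto simp: quadrilateral_def)
  then have nb: "L (fin_pt b) = line_dir a (b - a)" "L (fin_pt d) = line_dir a (d - a)"
    by (simp_all add: L_def vertex_line_other)
  have X: "L (span {v}) = line_dir a (vertex_dir a b c d v)"
    "L (span {v'}) = line_dir a (vertex_dir a b c d v')"
    unfolding L_def using assms by (simp_all add: vertex_line_eq_line_dir)
  have nz: "vertex_dir a b c d v \<noteq> 0" "vertex_dir a b c d v' \<noteq> 0" "b - a \<noteq> 0" "d - a \<noteq> 0"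
    using vertex_dir_nonzero[OF q] \<open>a \<noteq> b\<close> \<open>a \<noteq> d\<close> by simp_all
  show "isogonal a (L (span {v})) (L (span {v'})) (L (fin_pt b)) (L (fin_pt d))
      \<longleftrightarrow> isogonal_at a b c d v v'"
    unfolding X nb isogonal_line_dir[OF nz] isogonal_at_def ..
  show "isogonal a (L (span {v})) (L (span {v'})) (L (fin_pt d)) (L (fin_pt b))
      \<longleftrightarrow> isogonal_at a b c d v v'"
    unfolding X nb isogonal_line_dir[OF nz(1,2,4,3)] isogonal_at_def mult.commute[of "d - a" "b - a"] ..
qed

lemma isogonal_conjugates_iff:
  assumes q: "quadrilateral a b c d" and v: "v \<noteq> 0" "v' \<noteq> 0"
  shows "isogonal_conjugates a b c d (span {v}) (span {v'}) \<longleftrightarrow>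
    isogonal_at a b c d v v' \<and> isogonal_at b c d a v v' \<and>
    isogonal_at c d a b v v' \<and> isogonal_at d a b c v v'"
proof -
  have rot: "quadrilateral b c d a" "quadrilateral c d a b" "quadrilateral d a b c"
    using q by (auto simp: quadrilateral_def)
  have L: "vertex_line b c d a = vertex_line a b c d"
    "vertex_line c d a b = vertex_line a b c d" "vertex_line d a b c = vertex_line a b c d"
    by (intro ext; metis vertex_line_rotate)+
  have "span {v} \<in> RP2" "span {v'} \<in> RP2"
    using v by (simp_all add: RP2_def dim_span_singleton del: dim_span)
  \<comment> \<open>Rotation lists the neighbours of \<open>b\<close>, \<open>c\<close> and
    \<open>d\<close> in the opposite order from the definition, hence the second version
    there.\<close>
  note at = this isogonal_vertex_lines_iff(1)[OF q v] isogonal_vertex_lines_iff(2)[OF rot(1) v, unfolded L]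
    isogonal_vertex_lines_iff(2)[OF rot(2) v, unfolded L]
    isogonal_vertex_lines_iff(2)[OF rot(3) v, unfolded L]
  show ?thesis unfolding isogonal_conjugates_def Let_def by (simp only: at simp_thms)
qed

section \<open>Uniqueness of the conjugate in one quadrilateral\<close>

text \<open>For fixed \<open>v\<close> the point \<open>v'\<close> lies on one line through
  \<open>a\<close>. The vertex itself satisfies the linear equation trivially, which absorbs the
  tangent case for \<open>v'\<close>.\<close>

lemma isogonal_at_imp_on_line:
  assumes "isogonal_at a b c d v v'"
  shows "Im ((fst v' - of_real (snd v') * a) *
           (vertex_dir a b c d v * cnj ((b - a) * (d - a)))) = 0"
proof (cases "fst v' = of_real (snd v') * a")
  case False
  then have "vertex_dir a b c d v' = fst v' - of_real (snd v') * a" by (simp add: vertex_dir_def)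
  then show ?thesis using assms unfolding isogonal_at_def
    by (metis mult.assoc mult.commute)
qed simp

lemma Im_mult_eq_0_imp_parallel:
  assumes "e \<noteq> 0" "Im (u * e) = 0" "Im (v * e) = 0"
  shows "Re u * Im v = Im u * Re v"
proof -
  have "u \<in> line_dir 0 (cnj e)" "v \<in> line_dir 0 (cnj e)" using assms by (simp_all add: line_dir_eq)
  then obtain k l :: real where "u = of_real k * cnj e" "v = of_real l * cnj e"
    by (auto simp: line_dir_def)
  then show ?thesis by simp
qed

text \<open>Thus \<open>a + c - b - d\<close> is the direction of the only real point at infinity,
  unless it is 0 and the cubic contains the whole line at infinity.\<close>

lemma span_at_infinity_in_isogonal_cubic:
  assumes "v \<noteq> 0"
  shows "span {(v, 0)} \<in> isogonal_cubic a b c d \<longleftrightarrow> Im ((a + c - b - d) * cnj v) = 0"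
proof -
  have "isogonal_form a b c d (v, 0) = (cmod v)\<^sup>2 * Im ((a + c - b - d) * cnj v)"
    unfolding cmod_power2 by (simp add: isogonal_form_def Let_def power2_eq_square algebra_simps)
  then show ?thesis using assms by (simp add: span_in_isogonal_cubic zero_prod_def)
qed

text \<open>From a finite point of the common line, all differences to the vertices are real
  multiples of \<open>e\<close>, so the two sides of the cubic's equation agree. At infinity,
  \<open>a + c - b - d\<close> is such a multiple.\<close>

lemma collinear_imp_line_in_isogonal_cubic:
  assumes pq: "(p, q) \<noteq> (0, 0)"
    and on: "\<And>u. u \<in> {a, b, c, d} \<Longrightarrow> p * Re u + q * Im u + r = 0"
    and w: "(w, t) \<noteq> 0" "p * Re w + q * Im w + r * t = 0"
  shows "span {(w, t)} \<in> isogonal_cubic a b c d"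
proof -
  define e where "e = Complex (- q) p"
  have e: "e \<noteq> 0" using pq by (auto simp: e_def complex_eq_iff)
  have dir: "\<exists>k::real. z = of_real k * e" if "p * Re z + q * Im z = 0" for z
  proof -
    have "z \<in> line_dir 0 e" using e that by (simp add: line_dir_eq) (simp add: e_def algebra_simps)
    then show ?thesis by (auto simp: line_dir_def)
  qed
  show ?thesis
  proof (cases "t = 0")
    case True
    then obtain k where k: "w = of_real k * e" using dir[of w] w(2) by auto
    have "p * Re (a + c - b - d) + q * Im (a + c - b - d) = 0"
      using on[of a] on[of b] on[of c] on[of d] by (simp add: algebra_simps)
    then obtain l where "a + c - b - d = of_real l * e" using dir by blast
    then show ?thesis using k True w(1)
      by (simp add: span_at_infinity_in_isogonal_cubic zero_prod_def del: minus_complex.sel)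
  next
    case False
    have "p * Re (w - u * of_real t) + q * Im (w - u * of_real t) = 0" if "u \<in> {a, b, c, d}" for u
    proof -
      have "p * Re (w - u * of_real t) + q * Im (w - u * of_real t) =
          (p * Re w + q * Im w + r * t) - t * (p * Re u + q * Im u + r)"
        by (simp add: algebra_simps)
      then show ?thesis using on[OF that] w(2) by simp
    qed
    then obtain ka kb kc kd where k: "w - a * of_real t = of_real ka * e" "w - b * of_real t = of_real kb * e"
      "w - c * of_real t = of_real kc * e" "w - d * of_real t = of_real kd * e"
      using dir by (metis insertCI)
    have "2 * \<i> * of_real (t * isogonal_form a b c d (w, t)) = 0"
      unfolding isogonal_form_completion k by (simp add: mult_ac)
    then show ?thesis using False w(1) by (simp add: span_in_isogonal_cubic)
  qed
qed

text \<open>At each vertex, the conjugates of \<open>X\<close> lie on one line through that vertex.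
  Two distinct conjugates would put all four vertices on the line joining them, and the cubic would
  contain this line.\<close>

lemma isogonal_conjugate_unique:
  assumes q: "quadrilateral a b c d"
    and no_line: "contains_no_line (isogonal_cubic a b c d)"
    and Y: "isogonal_conjugates a b c d X Y" "isogonal_conjugates a b c d X Y'"
  shows "Y = Y'"
proof (rule ccontr)
  assume "Y \<noteq> Y'"
  have "X \<in> RP2" "Y \<in> RP2" "Y' \<in> RP2" using Y by (auto simp: isogonal_conjugates_def)
  then obtain v w t w' t' where v: "v \<noteq> 0" "(w, t) \<noteq> 0" "(w', t') \<noteq> 0"
    "X = span {v}" "Y = span {(w, t)}" "Y' = span {(w', t')}"
    using RP2_E by (metis surj_pair)
  \<comment> \<open>\<open>(p, q, r)\<close> is the cross product of the coordinates of
    \<open>Y\<close> and \<open>Y'\<close>, the line joining them.\<close>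
  define p where "p = Im w * t' - t * Im w'"
  define q where "q = t * Re w' - Re w * t'"
  define r where "r = Re w * Im w' - Im w * Re w'"
  have pqr: "(p, q, r) \<noteq> (0, 0, 0)"
    using span_eq_if_cross_zero[OF v(2,3)] \<open>Y \<noteq> Y'\<close> v by (auto simp: p_def q_def r_def)
  have on: "p * Re a + q * Im a + r = 0"
    if "quadrilateral a b c d" "isogonal_at a b c d v (w, t)" "isogonal_at a b c d v (w', t')"
    for a b c d
  proof -
    let ?e = "vertex_dir a b c d v * cnj ((b - a) * (d - a))"
    have "?e \<noteq> 0" using vertex_dir_nonzero[OF that(1)] that(1) by (auto simp: quadrilateral_def)
    then have "Re (w - of_real t * a) * Im (w' - of_real t' * a) =
        Im (w - of_real t * a) * Re (w' - of_real t' * a)"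
      by (rule Im_mult_eq_0_imp_parallel)
        (use isogonal_at_imp_on_line[OF that(2)] isogonal_at_imp_on_line[OF that(3)]
          in \<open>simp_all only: fst_conv snd_conv\<close>)
    then show ?thesis by (simp add: p_def q_def r_def algebra_simps)
  qed
  have "p * Re u + q * Im u + r = 0" if "u \<in> {a, b, c, d}" for u
  proof -
    have "quadrilateral b c d a" "quadrilateral c d a b" "quadrilateral d a b c"
      using \<open>quadrilateral a b c d\<close> by (auto simp: quadrilateral_def)
    note rot = \<open>quadrilateral a b c d\<close> this
    note at = Y[unfolded v(4-6) isogonal_conjugates_iff[OF rot(1) v(1,2)]
        isogonal_conjugates_iff[OF rot(1) v(1,3)]]
    have "p * Re a + q * Im a + r = 0" "p * Re b + q * Im b + r = 0"
      "p * Re c + q * Im c + r = 0" "p * Re d + q * Im d + r = 0"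
      using at on[OF rot(1)] on[OF rot(2)] on[OF rot(3)] on[OF rot(4)] by blast+
    then show ?thesis using that by blast
  qed
  moreover from this[of a] pqr have "(p, q) \<noteq> (0, 0)" by auto
  ultimately show False
    using no_line pqr unfolding contains_no_line_def
    using collinear_imp_line_in_isogonal_cubic[of p q a b c d r] by blast
qed

section \<open>Conjugation as a Moebius involution\<close>

text \<open>The hypotheses are invariant under rotating the labels, so whatever is proved at
  \<open>a\<close> holds at every vertex.\<close>

locale focal_quadrilateral =
  fixes a b c d f m :: complex
  assumes quad: "quadrilateral a b c d"
    and not_parallelogram: "a + c \<noteq> b + d"
    and ac: "(a - f) * (c - f) = m"
    and bd: "(b - f) * (d - f) = m"
begin

lemma rotate: "focal_quadrilateral b c d a f m"
  using quad not_parallelogram ac bd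
  by unfold_locales (auto simp: quadrilateral_def algebra_simps)

text \<open>If \<open>m\<close> were 0, then \<open>f\<close> would be a vertex of both opposite
  pairs.\<close>

lemma power_nonzero: "m \<noteq> 0"
  using quad ac bd by (auto simp: quadrilateral_def)

lemma vertex_ne_focus: "a \<noteq> f" "c \<noteq> f"
  using power_nonzero ac by auto

text \<open>This is why the focus and the point at infinity in direction
  \<open>a + c - b - d\<close> are conjugate: up to sign, their directions from \<open>a\<close>
  have the same product as the two sides.\<close>

lemma adjacent_product: "(b - a) * (d - a) = (a - f) * (a + c - b - d)"
proof -
  have "(b - a) * (d - a) = (b - f) * (d - f) - (a - f) * (c - f) + (a - f) * (a + c - b - d)"
    by (simp add: algebra_simps)
  then show ?thesis by (simp add: ac bd)
qed

text \<open>As polynomials in \<open>z\<close>, the products \<open>P\<close> and \<open>Q\<close>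
  both have constant term \<open>m\<close>, so they differ by a multiple of \<open>z\<close> only,
  and \<open>Im (Q * cnj Q)\<close> drops out.\<close>

lemma finite_iff:
  "fin_pt (f + z) \<in> isogonal_cubic a b c d \<longleftrightarrow>
     Im ((a + c - b - d) * z * cnj (z\<^sup>2 - (a + c - 2 * f) * z + m)) = 0"
proof -
  define P where "P = (f + z - b) * (f + z - d)"
  define Q where "Q = (f + z - a) * (f + z - c)"
  have Q: "Q = z\<^sup>2 - (a + c - 2 * f) * z + m"
    unfolding Q_def ac[symmetric] by (simp add: power2_eq_square algebra_simps)
  have "P = z\<^sup>2 - (b + d - 2 * f) * z + m"
    unfolding P_def bd[symmetric] by (simp add: power2_eq_square algebra_simps)
  then have P: "P = Q + (a + c - b - d) * z" unfolding Q by (simp add: algebra_simps)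
  have "fin_pt (f + z) \<in> isogonal_cubic a b c d \<longleftrightarrow> P * cnj Q = cnj P * Q"
    unfolding isogonal_cubic_finite P_def Q_def ..
  also have "\<dots> \<longleftrightarrow> Im (P * cnj Q) = 0" by (auto simp: complex_eq_iff)
  also have "Im (P * cnj Q) = Im ((a + c - b - d) * z * cnj Q)"
    unfolding P by (simp add: algebra_simps)
  finally show ?thesis unfolding Q .
qed

text \<open>Dividing by the square of \<open>cmod z\<close> leaves a condition on
  \<open>z + m / z\<close>, which is invariant under the involution.\<close>

lemma finite_nonzero_iff:
  assumes "z \<noteq> 0"
  shows "fin_pt (f + z) \<in> isogonal_cubic a b c d \<longleftrightarrow>
     Im ((a + c - b - d) * cnj (z + m / z - (a + c - 2 * f))) = 0"
proof -
  have "(a + c - b - d) * z * cnj (z\<^sup>2 - (a + c - 2 * f) * z + m) =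
      of_real ((cmod z)\<^sup>2) * ((a + c - b - d) * cnj (z + m / z - (a + c - 2 * f)))"
  proof -
    have "z\<^sup>2 - (a + c - 2 * f) * z + m = z * (z + m / z - (a + c - 2 * f))"
      using assms by (simp add: power2_eq_square field_simps)
    then show ?thesis unfolding complex_norm_square by (simp only: complex_cnj_mult mult_ac)
  qed
  then show ?thesis unfolding finite_iff using assms
    by (simp only: Im_complex_of_real Re_complex_of_real times_complex.sel(2)) simp
qed

lemma conjugate_in_cubic:
  assumes "z \<noteq> 0" "fin_pt (f + z) \<in> isogonal_cubic a b c d"
  shows "fin_pt (f + m / z) \<in> isogonal_cubic a b c d"
  using assms power_nonzero by (simp add: finite_nonzero_iff add.commute)

text \<open>Away from \<open>a\<close> and \<open>c\<close>, the condition at \<open>a\<close> turns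
  into the equation of the cubic in the form of \<open>finite_nonzero_iff\<close>. The points
  \<open>a\<close> and \<open>c\<close> are exchanged by the involution, and there the tangent
  convention enters.\<close>

lemma isogonal_at_finite:
  assumes z: "z \<noteq> 0" "fin_pt (f + z) \<in> isogonal_cubic a b c d"
  shows "isogonal_at a b c d (f + z, 1) (f + m / z, 1)"
proof -
  have opp: "Im ((a - b) * (a - d) * cnj (a - c) * (c - a) * cnj ((b - a) * (d - a))) = 0"
  proof -
    have "(a - b) * (a - d) * cnj (a - c) * (c - a) * cnj ((b - a) * (d - a)) =
        - (((a - b) * (a - d) * (a - c)) * cnj ((a - b) * (a - d) * (a - c)))"
      by (simp add: algebra_simps)
    also have "Im \<dots> = 0" by (simp only: complex_mult_cnj uminus_complex.sel Im_complex_of_real)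
    finally show ?thesis .
  qed
  have ne: "a \<noteq> c" using quad by (auto simp: quadrilateral_def)
  have ca: "m / (a - f) = c - f" "m / (c - f) = a - f"
    using vertex_ne_focus ac by (auto simp: field_simps)
  consider "z = a - f" | "z = c - f" | "z \<noteq> a - f" "z \<noteq> c - f" by blast
  then show ?thesis
  proof cases
    case 1
    then show ?thesis using opp ne ca by (simp add: isogonal_at_def vertex_dir_def)
  next
    case 2
    then have "isogonal_at a b c d (f + m / z, 1) (f + z, 1)"
      using opp ne ca by (simp add: isogonal_at_def vertex_dir_def)
    then show ?thesis by (simp add: isogonal_at_sym)
  next
    case 3
    define \<sigma> where "\<sigma> = a + c - b - d"
    define h where "h = z + m / z - (a + c - 2 * f)"
    have "m / z \<noteq> a - f"
    proof
      assume "m / z = a - f"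
      then have "(a - f) * z = (a - f) * (c - f)" using z(1) ac by (simp add: field_simps)
      then show False using 3 vertex_ne_focus by simp
    qed
    then have "isogonal_at a b c d (f + z, 1) (f + m / z, 1) \<longleftrightarrow>
        Im ((f + z - a) * (f + m / z - a) * cnj ((b - a) * (d - a))) = 0"
      using 3 by (simp add: isogonal_at_def vertex_dir_def algebra_simps)
    also have "(f + z - a) * (f + m / z - a) = - (a - f) * h"
    proof -
      have "z * (m / z) = (a - f) * (c - f)" using z(1) ac by simp
      then show ?thesis unfolding h_def by algebra
    qed
    also have "(b - a) * (d - a) = (a - f) * \<sigma>"
      by (simp only: adjacent_product \<sigma>_def)
    also have "- (a - f) * h * cnj ((a - f) * \<sigma>) =
        - of_real ((cmod (a - f))\<^sup>2) * cnj (\<sigma> * cnj h)"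
      unfolding complex_norm_square by (simp add: algebra_simps)
    also have "Im \<dots> = (cmod (a - f))\<^sup>2 * Im (\<sigma> * cnj h)"
      by (simp only: times_complex.sel(2) uminus_complex.sel Im_complex_of_real Re_complex_of_real
          cnj.sel)
    also have "\<dots> = 0" using z finite_nonzero_iff[OF z(1)] by (simp add: \<sigma>_def h_def)
    finally show ?thesis by simp
  qed
qed

lemma isogonal_at_focus:
  assumes "s \<noteq> 0" "Im ((a + c - b - d) * cnj s) = 0"
  shows "isogonal_at a b c d (f, 1) (s, 0)"
proof -
  define \<sigma> where "\<sigma> = a + c - b - d"
  have "isogonal_at a b c d (f, 1) (s, 0) \<longleftrightarrow> Im ((f - a) * s * cnj ((b - a) * (d - a))) = 0"
    using vertex_ne_focus assms(1) by (simp add: isogonal_at_def vertex_dir_def)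
  also have "(b - a) * (d - a) = (a - f) * \<sigma>"
    by (simp only: adjacent_product \<sigma>_def)
  also have "(f - a) * s * cnj ((a - f) * \<sigma>) = - of_real ((cmod (a - f))\<^sup>2) * cnj (\<sigma> * cnj s)"
    unfolding complex_norm_square by (simp add: algebra_simps)
  also have "Im \<dots> = (cmod (a - f))\<^sup>2 * Im (\<sigma> * cnj s)"
    by (simp only: times_complex.sel(2) uminus_complex.sel Im_complex_of_real Re_complex_of_real
        cnj.sel)
  also have "\<dots> = 0" using assms(2) by (simp add: \<sigma>_def)
  finally show ?thesis by simp
qed

lemma isogonal_conjugates_finite:
  assumes z: "z \<noteq> 0" "fin_pt (f + z) \<in> isogonal_cubic a b c d"
  shows "isogonal_conjugates a b c d (fin_pt (f + z)) (fin_pt (f + m / z))"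
proof -
  \<comment> \<open>Rotation changes neither the cubic nor \<open>f\<close> and \<open>m\<close>, so
    the condition at \<open>a\<close> yields those at the other vertices.\<close>
  interpret b: focal_quadrilateral b c d a f m by (rule rotate)
  interpret c: focal_quadrilateral c d a b f m by (rule b.rotate)
  interpret d: focal_quadrilateral d a b c f m by (rule c.rotate)
  have "isogonal_cubic b c d a = isogonal_cubic a b c d" "isogonal_cubic c d a b = isogonal_cubic a b c d"
    "isogonal_cubic d a b c = isogonal_cubic a b c d"
    by (simp_all add: isogonal_cubic_rotate)
  then show ?thesis unfolding fin_pt_def
    using z isogonal_at_finite b.isogonal_at_finite c.isogonal_at_finite d.isogonal_at_finite
    by (subst isogonal_conjugates_iff[OF quad]) (auto simp: zero_prod_def)
qed

lemma isogonal_conjugates_focus: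
  assumes s: "s \<noteq> 0" "Im ((a + c - b - d) * cnj s) = 0"
  shows "isogonal_conjugates a b c d (fin_pt f) (span {(s, 0)})"
    and "isogonal_conjugates a b c d (span {(s, 0)}) (fin_pt f)"
proof -
  interpret b: focal_quadrilateral b c d a f m by (rule rotate)
  interpret c: focal_quadrilateral c d a b f m by (rule b.rotate)
  interpret d: focal_quadrilateral d a b c f m by (rule c.rotate)
  have at: "isogonal_at a b c d (f, 1) (s, 0)" "isogonal_at b c d a (f, 1) (s, 0)"
    "isogonal_at c d a b (f, 1) (s, 0)" "isogonal_at d a b c (f, 1) (s, 0)"
    by (rule isogonal_at_focus b.isogonal_at_focus c.isogonal_at_focus d.isogonal_at_focus;
        use s in \<open>simp add: algebra_simps\<close>)+
  show "isogonal_conjugates a b c d (fin_pt f) (span {(s, 0)})"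
    unfolding fin_pt_def using at s(1)
    by (subst isogonal_conjugates_iff[OF quad]) (simp_all add: zero_prod_def)
  show "isogonal_conjugates a b c d (span {(s, 0)}) (fin_pt f)"
    unfolding fin_pt_def using at[THEN isogonal_at_sym[THEN iffD1]] s(1)
    by (subst isogonal_conjugates_iff[OF quad]) (simp_all add: zero_prod_def)
qed

text \<open>The factor \<open>\<rho>\<close> lets two quadrilaterals with the same cubic share one
  \<open>s\<close>, although their values of \<open>a + c - b - d\<close> are only parallel.\<close>

lemma normal_form:
  assumes s: "s \<noteq> 0" "\<rho> \<noteq> 0" "a + c - b - d = of_real \<rho> * s"
  shows "fin_pt (f + s * z) \<in> isogonal_cubic a b c d \<longleftrightarrow>
    circular_cubic (Im ((a + c - 2 * f) / s)) (m / s\<^sup>2) z = 0"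
proof -
  define \<kappa> where "\<kappa> = (a + c - 2 * f) / s"
  define n where "n = m / s\<^sup>2"
  have \<kappa>: "a + c - 2 * f = \<kappa> * s" and n: "m = n * s\<^sup>2" using s(1) by (auto simp: \<kappa>_def n_def)
  have "(a + c - b - d) * (s * z) * cnj ((s * z)\<^sup>2 - (a + c - 2 * f) * (s * z) + m) =
      of_real (\<rho> * (cmod s)\<^sup>2 * (cmod s)\<^sup>2) * (z * cnj (z\<^sup>2 - \<kappa> * z + n))"
    unfolding s(3) \<kappa> n of_real_mult complex_norm_square
    by (simp add: power2_eq_square algebra_simps)
  moreover have "Im (z * cnj (z\<^sup>2 - \<kappa> * z + n)) = - circular_cubic (Im \<kappa>) n z"
    unfolding circular_cubic_def cmod_power2 by (simp add: power2_eq_square algebra_simps)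
  ultimately have "Im ((a + c - b - d) * (s * z) * cnj ((s * z)\<^sup>2 - (a + c - 2 * f) * (s * z) + m)) =
      - (\<rho> * (cmod s)\<^sup>2 * (cmod s)\<^sup>2) * circular_cubic (Im \<kappa>) n z"
    by (simp only: Im_complex_of_real Re_complex_of_real times_complex.sel(2)) simp
  then show ?thesis unfolding finite_iff \<kappa>_def[symmetric] n_def[symmetric]
    using s(1,2) by simp
qed

end

section \<open>Focus and power are determined by the cubic\<close>

lemma ex_focal_quadrilateral:
  assumes "quadrilateral a b c d" "a + c \<noteq> b + d"
  shows "\<exists>f m. focal_quadrilateral a b c d f m"
proof -
  \<comment> \<open>The solution of \<open>(a - f) * (c - f) = (b - f) * (d - f)\<close>, which is
    linear in \<open>f\<close>.\<close>
  define f where "f = (a * c - b * d) / (a + c - b - d)"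
  have "a + c - b - d \<noteq> 0" using assms(2) by (simp add: algebra_simps)
  then have "f * (a + c - b - d) = a * c - b * d" by (simp add: f_def)
  then have "(b - f) * (d - f) = (a - f) * (c - f)" by algebra
  then have "focal_quadrilateral a b c d f ((a - f) * (c - f))"
    using assms by unfold_locales auto
  then show ?thesis by blast
qed

lemma not_parallelogram_if_contains_no_line:
  assumes "contains_no_line (isogonal_cubic a b c d)"
  shows "a + c \<noteq> b + d"
proof
  assume eq: "a + c = b + d"
  have "(0, 0, 1) \<noteq> (0, 0, 0 :: real)" by simp
  then obtain w and t :: real where "(w, t) \<noteq> 0" "0 * Re w + 0 * Im w + 1 * t = 0"
    and notin: "span {(w, t)} \<notin> isogonal_cubic a b c d"
    using assms unfolding contains_no_line_def by blast
  then have "w \<noteq> 0" "t = 0" by (auto simp: zero_prod_def)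
  moreover have "a + c - b - d = 0" using eq by (simp add: algebra_simps)
  ultimately show False using notin by (simp add: span_at_infinity_in_isogonal_cubic del: minus_complex.sel)
qed

text \<open>The common point at infinity makes \<open>s'\<close> a real multiple of
  \<open>s\<close>. Scaling by \<open>s\<close> brings both equations to normal form, with the shift
  \<open>g\<close> between the foci, and \<open>circular_cubic_unique\<close> applies.\<close>

lemma focal_data_unique:
  assumes "focal_quadrilateral a b c d f m" "focal_quadrilateral a' b' c' d' f' m'"
    and K: "isogonal_cubic a' b' c' d' = isogonal_cubic a b c d"
    and no_line: "contains_no_line (isogonal_cubic a b c d)"
  shows "f' = f" "m' = m"
proof -
  interpret Q: focal_quadrilateral a b c d f m by fact
  interpret Q': focal_quadrilateral a' b' c' d' f' m' by fact
  define s where "s = a + c - b - d"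
  define s' where "s' = a' + c' - b' - d'"
  have s: "s \<noteq> 0" "s' \<noteq> 0"
    using Q.not_parallelogram Q'.not_parallelogram by (auto simp: s_def s'_def algebra_simps)
  have inf: "span {(v, 0)} \<in> isogonal_cubic a b c d \<longleftrightarrow> Im (s * cnj v) = 0" if "v \<noteq> 0" for v
    unfolding span_at_infinity_in_isogonal_cubic[OF that] s_def ..
  have "span {(s, 0)} \<in> isogonal_cubic a' b' c' d'"
    unfolding K using s inf by simp
  then have "Im (s' * cnj s) = 0"
    unfolding span_at_infinity_in_isogonal_cubic[OF s(1)] s'_def .
  then have "s' \<in> line_dir 0 s" using s by (simp add: line_dir_eq)
  then obtain \<rho> :: real where \<rho>: "s' = of_real \<rho> * s" by (auto simp: line_dir_def)
  define k n k' n' g where "k = Im ((a + c - 2 * f) / s)" "n = m / s\<^sup>2"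
    "k' = Im ((a' + c' - 2 * f') / s)" "n' = m' / s\<^sup>2" "g = (f' - f) / s"
  have nf: "fin_pt (f + s * z) \<in> isogonal_cubic a b c d \<longleftrightarrow> circular_cubic k n z = 0" for z
    unfolding k_n_k'_n'_g_def using s by (intro Q.normal_form[where \<rho> = 1]) (auto simp: s_def)
  have nf': "fin_pt (f' + s * z) \<in> isogonal_cubic a b c d \<longleftrightarrow> circular_cubic k' n' z = 0" for z
    unfolding k_n_k'_n'_g_def K[symmetric] using s \<rho>
    by (intro Q'.normal_form[where \<rho> = \<rho>]) (auto simp: s'_def)
  have sub: "circular_cubic k' n' (z - g) = 0" if "circular_cubic k n z = 0" for z
  proof -
    have "f' + s * (z - g) = f + s * z" using s by (simp add: k_n_k'_n'_g_def field_simps)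
    then show ?thesis using that nf[of z] nf'[of "z - g"] by simp
  qed
  have "\<exists>y. circular_cubic k n (Complex y x) \<noteq> 0" for x
  proof -
    \<comment> \<open>With this \<open>r\<close> the line becomes \<open>Im z = x\<close> in the
      normalised coordinate \<open>z\<close>. Its point at infinity is on the cubic, so the point
      missed by the cubic is finite.\<close>
    define r where "r = - Im (f * cnj s) - (cmod s)\<^sup>2 * x"
    have "(- Im s, Re s, r) \<noteq> (0, 0, 0)" using s by (auto simp: complex_eq_iff)
    then obtain w t where wt: "(w, t) \<noteq> 0" "- Im s * Re w + Re s * Im w + r * t = 0"
      and notin: "span {(w, t)} \<notin> isogonal_cubic a b c d"
      using no_line unfolding contains_no_line_def by blast
    have t: "t \<noteq> 0"
    proof
      assume "t = 0"
      then have "w \<noteq> 0" "Im (s * cnj w) = 0" using wt by (auto simp: zero_prod_def algebra_simps)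
      then show False using notin inf \<open>t = 0\<close> by blast
    qed
    define z where "z = (w / of_real t - f) / s"
    have wz: "w = of_real t * (f + s * z)" using s t by (simp add: z_def)
    have "t * (cmod s)\<^sup>2 * (Im z - x) = - Im s * Re w + Re s * Im w + r * t"
      unfolding wz r_def cmod_power2 by (simp add: power2_eq_square algebra_simps)
    then have "Im z = x" using wt s t by simp
    then have "Complex (Re z) x = z" by (simp add: complex_eq_iff)
    moreover have "span {(w, t)} = fin_pt (f + s * z)"
      using span_Pair_eq_fin_pt[OF t, of w] s t by (simp add: z_def)
    ultimately show ?thesis using notin nf[of z] by metis
  qed
  note unique = circular_cubic_unique[of k n k' n' g, OF sub this]
  show "f' = f" "m' = m" using s unique by (auto simp: k_n_k'_n'_g_def)
qed

theorem theorem7p2: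
  fixes K :: "(complex \<times> real) set set"
    and a b c d a\<^sub>1 b\<^sub>1 c\<^sub>1 d\<^sub>1 :: complex
    and X :: "(complex \<times> real) set"
  assumes "nondegenerate_cubic K"
    and "quadrilateral a b c d" and "K = isogonal_cubic a b c d"
    and "quadrilateral a\<^sub>1 b\<^sub>1 c\<^sub>1 d\<^sub>1" and "K = isogonal_cubic a\<^sub>1 b\<^sub>1 c\<^sub>1 d\<^sub>1"
    and "X \<in> K"
  shows "\<exists>X'\<in>K. (\<forall>Y. isogonal_conjugates a b c d X Y \<longleftrightarrow> Y = X') \<and>
                 (\<forall>Y. isogonal_conjugates a\<^sub>1 b\<^sub>1 c\<^sub>1 d\<^sub>1 X Y \<longleftrightarrow> Y = X')"
proof -
  have no_line: "contains_no_line K" using assms(1) by (rule nondegenerate_cubic_contains_no_line)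
  then have ne: "a + c \<noteq> b + d" "a\<^sub>1 + c\<^sub>1 \<noteq> b\<^sub>1 + d\<^sub>1"
    using assms(3,5) not_parallelogram_if_contains_no_line by metis+
  obtain f m where "focal_quadrilateral a b c d f m"
    using ex_focal_quadrilateral[OF assms(2) ne(1)] by blast
  then interpret Q: focal_quadrilateral a b c d f m .
  obtain f\<^sub>1 m\<^sub>1 where Q1: "focal_quadrilateral a\<^sub>1 b\<^sub>1 c\<^sub>1 d\<^sub>1 f\<^sub>1 m\<^sub>1"
    using ex_focal_quadrilateral[OF assms(4) ne(2)] by blast
  have "f\<^sub>1 = f" "m\<^sub>1 = m"
    using focal_data_unique[OF Q.focal_quadrilateral_axioms Q1] assms(3,5) no_line by auto
  then interpret Q1: focal_quadrilateral a\<^sub>1 b\<^sub>1 c\<^sub>1 d\<^sub>1 f m using Q1 by simp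
  \<comment> \<open>Both quadrilaterals now have the same involution. Its image of \<open>X\<close>
    is conjugate to \<open>X\<close> in both; the focus and the point at infinity, which it
    exchanges, are treated apart.\<close>
  have "\<exists>X'\<in>K. isogonal_conjugates a b c d X X' \<and> isogonal_conjugates a\<^sub>1 b\<^sub>1 c\<^sub>1 d\<^sub>1 X X'"
  proof -
    have "X \<in> RP2" using assms(3,6) by (auto simp: isogonal_cubic_def zero_locus_def)
    then obtain w t where wt: "(w, t) \<noteq> 0" "X = span {(w, t)}"
      using RP2_E by (metis surj_pair)
    consider (finite) z where "z \<noteq> 0" "X = fin_pt (f + z)" | (focus) "X = fin_pt f"
      | (infinite) "w \<noteq> 0" "X = span {(w, 0)}"
    proof (cases "t = 0")
      case True
      then show ?thesis using wt infinite by (simp add: zero_prod_def)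
    next
      case False
      then have "X = fin_pt (f + (w / of_real t - f))" using wt by (simp add: span_Pair_eq_fin_pt)
      then show ?thesis using finite focus by (metis add.right_neutral)
    qed
    then show ?thesis
    proof cases
      case finite
      then show ?thesis
        using assms(3,5,6) Q.conjugate_in_cubic Q.isogonal_conjugates_finite
          Q1.isogonal_conjugates_finite by blast
    next
      case focus
      define s where "s = a + c - b - d"
      have s: "s \<noteq> 0" "Im (s * cnj s) = 0" using ne by (auto simp: s_def algebra_simps)
      have "span {(s, 0)} \<in> K"
        using s(2) unfolding assms(3) span_at_infinity_in_isogonal_cubic[OF s(1)]
        unfolding s_def .
      \<comment> \<open>The second quadrilateral has the same point at infinity because it has the
        same cubic.\<close>
      moreover from this have "Im ((a\<^sub>1 + c\<^sub>1 - b\<^sub>1 - d\<^sub>1) * cnj s) = 0"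
        unfolding assms(5) span_at_infinity_in_isogonal_cubic[OF s(1)] .
      ultimately show ?thesis unfolding focus
        using s Q.isogonal_conjugates_focus(1)[OF s(1)] Q1.isogonal_conjugates_focus(1)[OF s(1)]
        unfolding s_def by blast
    next
      case infinite
      have "fin_pt f \<in> K" using Q.finite_iff[of 0] assms(3) by simp
      moreover have "Im ((a + c - b - d) * cnj w) = 0" "Im ((a\<^sub>1 + c\<^sub>1 - b\<^sub>1 - d\<^sub>1) * cnj w) = 0"
        using assms(3,5,6) span_at_infinity_in_isogonal_cubic[OF infinite(1)]
        unfolding infinite(2) by blast+
      ultimately show ?thesis unfolding infinite(2)
        using Q.isogonal_conjugates_focus(2)[OF infinite(1)]
          Q1.isogonal_conjugates_focus(2)[OF infinite(1)] by blast
    qed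
  qed
  then show ?thesis
    using isogonal_conjugate_unique[OF assms(2)] isogonal_conjugate_unique[OF assms(4)]
      no_line assms(3,5) by metis
qed

end
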